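(* Consider a Fisher market instance with finite agent set $\mathcal{A}$, finite goods set $\mathcal{M}$, budgets $b_i>0$ and utility functions $u_i$, $i\in\mathcal{A}$, where every $u_i$ is a generalized network utility function. Then, for any thrifty competitive equilibrium $((\mathbf{x}_i)_{i\in\mathcal{A}},\mathbf{p})$ and any Nash welfare maximizing allocation $(\mathbf{y}_i)_{i\in\mathcal{A}}$, we have $u_i(\mathbf{y}_i)\ge\frac12u_i(\mathbf{x}_i)$ for every $i\in\mathcal{A}$.
   Context: Generalized flow instance: a finite directed graph $G=(V,E)$ (parallel arcs allowed) with a sink $t\in V$, a supply set $S\subseteq V\setminus\{t\}$, arc capacities $h_e\in\mathbb{R}_{\ge0}\cup\{\infty\}$ and gain factors $\gamma_e>0$, $e\in E$. For $\mathbf{f}\in\mathbb{R}_{\ge0}^E$ the net flow at $v$ is $\operatorname{net}_{\mathbf{f}}(v)=\sum_{e\text{ entering }v}\gamma_ef_e-\sum_{e\text{ leaving }v}f_e$. For a supply vector $\mathbf{x}\in\mathbb{R}_{\ge0}^S$, the maximum generalized flow value from supply $\mathbf{x}$ is the maximum of $\operatorname{net}_{\mathbf{f}}(t)$ over all $\mathbf{f}\in\mathbb{R}^E$ with $0\le f_e\le h_e$ for all $e\in E$, $\operatorname{net}_{\mathbf{f}}(v)\ge-x_v$ for all $v\in S$, and $\operatorname{net}_{\mathbf{f}}(v)\ge0$ for all $v\in V\setminus(S\cup\{t\})$. Generalized network utility function: $u:\mathbb{R}_{\ge0}^{\mathcal{M}}\to\mathbb{R}_{\ge0}$ such that $u(\mathbf{x})$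 is the maximum generalized flow value from supply $\mathbf{x}$ in some generalized flow instance with supply set $S=\mathcal{M}$, where this value is finite for every supply vector, $u(\mathbf{0})=0$, and $u(\mathbf{x})>0$ for some $\mathbf{x}$. Fisher market instance: a finite set $\mathcal{A}$ of agents, a finite set $\mathcal{M}$ of divisible goods with one unit of each good available, and for each agent $i$ a utility function $u_i$ and a budget $b_i>0$. An allocation is $(\mathbf{x}_i)_{i\in\mathcal{A}}$ with $\mathbf{x}_i\in\mathbb{R}_{\ge 0}^{\mathcal{M}}$. Prices are $\mathbf{p}\in\mathbb{R}_{\ge0}^{\mathcal{M}}$. The demand correspondence of agent $i$ is $\mathcal{D}_i(\mathbf{p},b_i)=\arg\max\{u_i(\mathbf{z}):\mathbf{z}\in\mathbb{R}_{\ge0}^{\mathcal{M}},\ \langle\mathbf{p},\mathbf{z}\rangle\le b_i\}$. Competitive equilibrium: $((\mathbf{x}_i)_{i\in\mathcal{A}},\mathbf{p})$ such that (i) $\mathbf{x}_i\in\mathcal{D}_i(\mathbf{p},b_i)$ for every $i$; (ii) $\sum_i x_{ij}\le 1$ for all $j$; (iii) $\sum_i x_{ij}=1$ whenever $p_j>0$. It is thrifty if moreover, for every $i$, $\mathbf{x}_i$ minimizes $\langle\mathbf{p},\mathbf{z}\rangle$ over $\mathbf{z}\in\mathcal{D}_i(\mathbf{p},b_i)$. Nash welfare of $(\mathbf{y}_i)$: $\left(\prod_{i} u_i(\mathbf{y}_i)^{b_i}\right)^{1/\sum_i b_i}$. A Nash welfare maximizing allocation attains the highest Nash welfare among all allocations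 with $\sum_i y_{ij}\le 1$ for all $j$. *)

theory Defs
  imports
    "HOL-Library.FuncSet"
    "HOL-Library.Extended_Real"
    "Graph_Theory.Digraph"
begin

section \<open>Generalized flows\<close>

text \<open>
  Vectors indexed by a finite set \<open>I\<close> are functions of which only the values on \<open>I\<close>
  matter; the nonnegative ones are the members of \<open>I \<rightarrow> {0..}\<close>.
\<close>

locale gen_flow_instance = fin_digraph G
  for G :: "('v, 'e) pre_digraph" (structure) +
  fixes t :: 'v
    and S :: "'v set"
    and h :: "'e \<Rightarrow> ereal"
    and \<gamma> :: "'e \<Rightarrow> real"
  assumes sink_in_verts: "t \<in> verts G"
    and supply_subset: "S \<subseteq> verts G - {t}"
    and capacity_nonneg: "e \<in> arcs G \<Longrightarrow> 0 \<le> h e"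
    and gain_pos: "e \<in> arcs G \<Longrightarrow> 0 < \<gamma> e"

definition net_flow ::
    "('v, 'e) pre_digraph \<Rightarrow> ('e \<Rightarrow> real) \<Rightarrow> ('e \<Rightarrow> real) \<Rightarrow> 'v \<Rightarrow> real" where
  "net_flow G \<gamma> f v = (\<Sum>e\<in>in_arcs G v. \<gamma> e * f e) - (\<Sum>e\<in>out_arcs G v. f e)"

definition feasible_flows ::
    "('v, 'e) pre_digraph \<Rightarrow> 'v \<Rightarrow> 'v set \<Rightarrow> ('e \<Rightarrow> ereal) \<Rightarrow> ('e \<Rightarrow> real)
      \<Rightarrow> ('v \<Rightarrow> real) \<Rightarrow> ('e \<Rightarrow> real) set" where
  "feasible_flows G t S h \<gamma> x =
    {f. (\<forall>e\<in>arcs G. 0 \<le> f e \<and> ereal (f e) \<le> h e)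
      \<and> (\<forall>v\<in>S. - x v \<le> net_flow G \<gamma> f v)
      \<and> (\<forall>v\<in>verts G - (S \<union> {t}). 0 \<le> net_flow G \<gamma> f v)}"

text \<open>
  Being the maximum includes that it is attained; if the flow values are unbounded, no
  real number satisfies this predicate.
\<close>

definition is_max_flow_value ::
    "('v, 'e) pre_digraph \<Rightarrow> 'v \<Rightarrow> 'v set \<Rightarrow> ('e \<Rightarrow> ereal) \<Rightarrow> ('e \<Rightarrow> real)
      \<Rightarrow> ('v \<Rightarrow> real) \<Rightarrow> real \<Rightarrow> bool" where
  "is_max_flow_value G t S h \<gamma> x val \<longleftrightarrow>
    (\<exists>f. is_arg_max (\<lambda>f. net_flow G \<gamma> f t) (\<lambda>f. f \<in> feasible_flows G t S h \<gamma> x) f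
       \<and> val = net_flow G \<gamma> f t)"

text \<open>
  The goods occur as the vertices \<open>Inl j\<close>. Since the graph is finite, naming the
  remaining vertices and the arcs by natural numbers is no loss of generality.
\<close>

definition gen_network_utility :: "'g set \<Rightarrow> (('g \<Rightarrow> real) \<Rightarrow> real) \<Rightarrow> bool" where
  "gen_network_utility M u \<longleftrightarrow>
    (\<exists>(G :: ('g + nat, nat) pre_digraph) t h \<gamma>.
        gen_flow_instance G t (Inl ` M) h \<gamma>
      \<and> (\<forall>x \<in> M \<rightarrow> {0..}. is_max_flow_value G t (Inl ` M) h \<gamma> (case_sum x (\<lambda>_. 0)) (u x)))
    \<and> (\<forall>x \<in> M \<rightarrow> {0..}. 0 \<le> u x)
    \<and> u (\<lambda>_. 0) = 0
    \<and> (\<exists>x \<in> M \<rightarrow> {0..}. 0 < u x)"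

section \<open>Fisher markets\<close>

definition cost :: "'g set \<Rightarrow> ('g \<Rightarrow> real) \<Rightarrow> ('g \<Rightarrow> real) \<Rightarrow> real" where
  "cost M p z = (\<Sum>j\<in>M. p j * z j)"

definition demand ::
    "'g set \<Rightarrow> (('g \<Rightarrow> real) \<Rightarrow> real) \<Rightarrow> ('g \<Rightarrow> real) \<Rightarrow> real \<Rightarrow> ('g \<Rightarrow> real) set" where
  "demand M u p b = {z. is_arg_max u (\<lambda>z. z \<in> M \<rightarrow> {0..} \<and> cost M p z \<le> b) z}"

definition competitive_equilibrium ::
    "'a set \<Rightarrow> 'g set \<Rightarrow> ('a \<Rightarrow> ('g \<Rightarrow> real) \<Rightarrow> real) \<Rightarrow> ('a \<Rightarrow> real)
      \<Rightarrow> ('a \<Rightarrow> 'g \<Rightarrow> real) \<Rightarrow> ('g \<Rightarrow> real) \<Rightarrow> bool" where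
  "competitive_equilibrium A M u b x p \<longleftrightarrow>
      p \<in> M \<rightarrow> {0..}
    \<and> (\<forall>i\<in>A. x i \<in> demand M (u i) p (b i))
    \<and> (\<forall>j\<in>M. (\<Sum>i\<in>A. x i j) \<le> 1)
    \<and> (\<forall>j\<in>M. 0 < p j \<longrightarrow> (\<Sum>i\<in>A. x i j) = 1)"

definition thrifty_competitive_equilibrium ::
    "'a set \<Rightarrow> 'g set \<Rightarrow> ('a \<Rightarrow> ('g \<Rightarrow> real) \<Rightarrow> real) \<Rightarrow> ('a \<Rightarrow> real)
      \<Rightarrow> ('a \<Rightarrow> 'g \<Rightarrow> real) \<Rightarrow> ('g \<Rightarrow> real) \<Rightarrow> bool" where
  "thrifty_competitive_equilibrium A M u b x p \<longleftrightarrow>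
      competitive_equilibrium A M u b x p
    \<and> (\<forall>i\<in>A. is_arg_min (cost M p) (\<lambda>z. z \<in> demand M (u i) p (b i)) (x i))"

definition nash_welfare ::
    "'a set \<Rightarrow> ('a \<Rightarrow> ('g \<Rightarrow> real) \<Rightarrow> real) \<Rightarrow> ('a \<Rightarrow> real) \<Rightarrow> ('a \<Rightarrow> 'g \<Rightarrow> real) \<Rightarrow> real" where
  "nash_welfare A u b y = (\<Prod>i\<in>A. u i (y i) powr b i) powr (1 / (\<Sum>i\<in>A. b i))"

definition feasible_allocations :: "'a set \<Rightarrow> 'g set \<Rightarrow> ('a \<Rightarrow> 'g \<Rightarrow> real) set" where
  "feasible_allocations A M =
    {y. (\<forall>i\<in>A. y i \<in> M \<rightarrow> {0..}) \<and> (\<forall>j\<in>M. (\<Sum>i\<in>A. y i j) \<le> 1)}"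

definition nash_welfare_maximizing ::
    "'a set \<Rightarrow> 'g set \<Rightarrow> ('a \<Rightarrow> ('g \<Rightarrow> real) \<Rightarrow> real) \<Rightarrow> ('a \<Rightarrow> real)
      \<Rightarrow> ('a \<Rightarrow> 'g \<Rightarrow> real) \<Rightarrow> bool" where
  "nash_welfare_maximizing A M u b y \<longleftrightarrow>
    is_arg_max (nash_welfare A u b) (\<lambda>y. y \<in> feasible_allocations A M) y"

end

theory Submission
  imports Defs
begin

text \<open>
  The dual of a generalized flow problem asks for vertex potentials subject to constraints
  \<open>\<gamma>\<^sub>e \<pi>(head e) - \<pi>(tail e) \<le> \<beta>\<^sub>e\<close>. Such systems form a lattice and the dual cost is
  submodular on it, so the value \<open>\<psi>(p, r) = sup\<^sub>z (r u(z) - \<langle>p, z\<rangle>)\<close> of a generalized network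
  utility is jointly submodular in the prices \<open>p\<close> and the utility weight \<open>r\<close>.

  A Nash welfare maximizer \<open>y\<close> has Lagrange prices \<open>q\<close> such that every \<open>y\<^sub>i\<close> attains
  \<open>\<psi>\<^sub>i(q, r\<^sub>i)\<close> with \<open>r\<^sub>i = b\<^sub>i / u\<^sub>i(y\<^sub>i)\<close>; in a thrifty equilibrium \<open>(x, p)\<close>, every \<open>x\<^sub>i\<close> attains
  \<open>\<psi>\<^sub>i(p, r'\<^sub>i)\<close> for some \<open>r'\<^sub>i\<close>. Summing submodularity over the agents shows that
  \<open>min p q\<close> also supports \<open>y\<close>, so one may assume \<open>q \<le> p\<close>. Then
  \<open>r\<^sub>i (u\<^sub>i(x\<^sub>i) - u\<^sub>i(y\<^sub>i)) \<le> \<langle>q, x\<^sub>i\<rangle> - \<langle>q, y\<^sub>i\<rangle> \<le> \<langle>p, x\<^sub>i\<rangle> \<le> b\<^sub>i\<close>, which is the claim.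
\<close>

section \<open>Farkas' lemma\<close>

text \<open>A single identity packs additivity and homogeneity, so linearity of a form is one
  equation between terms. The domain is the full function space over an arbitrary index
  type.\<close>

definition linear_form :: "(('k \<Rightarrow> real) \<Rightarrow> real) \<Rightarrow> bool" where
  "linear_form L \<longleftrightarrow> (\<forall>x y s. L (\<lambda>k. x k + s * y k) = L x + s * L y)"

lemma linear_formD: "linear_form L \<Longrightarrow> L (\<lambda>k. x k + s * y k) = L x + s * L y"
  by (simp add: linear_form_def)

lemma linear_form_zero:
  assumes "linear_form L" shows "L (\<lambda>_. 0) = 0"
  using linear_formD[OF assms, of "\<lambda>_. 0" 1 "\<lambda>_. 0"] by simp

lemma linear_form_scale:
  assumes "linear_form L" shows "L (\<lambda>k. s * x k) = s * L x"
  using linear_formD[OF assms, of "\<lambda>_. 0" s x] linear_form_zero[OF assms] by simp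

text \<open>Induction on the number of constraints, with no topology or dimension count. If
  constraint \<open>n\<close> matters, some \<open>w\<close> violates it alone with
  \<open>c w > 0\<close>; projecting along \<open>w\<close> onto the kernel of \<open>a n\<close>
  leaves the forms indexed by \<open>I\<close>, and the multiplier of \<open>n\<close> is read off
  from the direction of projection.\<close>

lemma farkas:
  fixes a :: "'i \<Rightarrow> ('k \<Rightarrow> real) \<Rightarrow> real"
  assumes "finite I"
    and "\<And>i. i \<in> I \<Longrightarrow> linear_form (a i)"
    and "linear_form c"
    and "\<And>x. (\<And>i. i \<in> I \<Longrightarrow> a i x \<le> 0) \<Longrightarrow> c x \<le> 0"
  shows "\<exists>l. (\<forall>i\<in>I. 0 \<le> l i) \<and> (\<forall>x. c x = (\<Sum>i\<in>I. l i * a i x))"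
  using assms
proof (induction I arbitrary: a c rule: finite_induct)
  case empty
  have "c x = 0" for x
  proof -
    have "c x \<le> 0" "c (\<lambda>k. -1 * x k) \<le> 0"
      using empty.prems(3) by simp_all
    then show ?thesis
      by (simp only: linear_form_scale[OF empty.prems(2)])
  qed
  then show ?case by simp
next
  case (insert n I)
  note lin = linear_formD[OF insert.prems(1)] linear_formD[OF insert.prems(2)]
  show ?case
  proof (cases "\<forall>x. (\<forall>i\<in>I. a i x \<le> 0) \<longrightarrow> c x \<le> 0")
    case True
    obtain l where l: "\<forall>i\<in>I. 0 \<le> l i" "\<forall>x. c x = (\<Sum>i\<in>I. l i * a i x)"
      using insert.IH[of a c] insert.prems True by (metis insertCI)
    have "(\<Sum>i\<in>insert n I. (l(n := 0)) i * a i x) = c x" for x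
    proof -
      have "(\<Sum>i\<in>I. (l(n := 0)) i * a i x) = (\<Sum>i\<in>I. l i * a i x)"
        using insert.hyps by (intro sum.cong) auto
      then show ?thesis using l insert.hyps by simp
    qed
    then show ?thesis using l by (intro exI[of _ "l(n := 0)"]) auto
  next
    case False
    then obtain w where w: "\<And>i. i \<in> I \<Longrightarrow> a i w \<le> 0" "0 < c w" by (auto simp: not_le)
    have "0 < a n w"
      using insert.prems(3)[of w] w by (metis insertE not_le)
    \<comment> \<open>Normalized so that \<open>a n d = 1\<close>; then \<open>P\<close> below is
      the projection along \<open>d\<close> onto the kernel of \<open>a n\<close>, where constraint
      \<open>n\<close> holds automatically.\<close>
    define d where "d = (\<lambda>k. inverse (a n w) * w k)"
    have an: "linear_form (a n)" using insert.prems(1) by simp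
    have d: "a n d = 1" "\<And>i. i \<in> I \<Longrightarrow> a i d \<le> 0" "0 < c d"
      using \<open>0 < a n w\<close> w insert.prems(1,2)
      by (auto simp: d_def linear_form_scale mult_le_0_iff)
    define P where "P = (\<lambda>x k. x k + (- a n x) * d k)"
    have P_an: "a n (P x) = 0" for x
      unfolding P_def by (simp add: linear_formD[OF an] d(1) del: mult_minus_left)
    have P_lin: "linear_form (\<lambda>x. L (P x))" if "linear_form L" for L
    proof -
      have "P (\<lambda>k. x k + s * y k) = (\<lambda>k. P x k + s * P y k)" for x y s
        unfolding P_def linear_formD[OF an] by (simp add: algebra_simps)
      then show ?thesis
        using that by (simp add: linear_form_def)
    qed
    have P_eq: "L (P x) = L x - a n x * L d" if "linear_form L" for L x
      unfolding P_def linear_formD[OF that] by simp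
    have "\<exists>l. (\<forall>i\<in>I. 0 \<le> l i) \<and> (\<forall>x. c (P x) = (\<Sum>i\<in>I. l i * a i (P x)))"
    proof (rule insert.IH[of "\<lambda>i x. a i (P x)" "\<lambda>x. c (P x)"])
      show "c (P x) \<le> 0" if "\<And>i. i \<in> I \<Longrightarrow> a i (P x) \<le> 0" for x
        using insert.prems(3)[of "P x"] that P_an[of x] by (metis insertE order_refl)
    qed (use insert.prems P_lin in auto)
    then obtain l where l: "\<forall>i\<in>I. 0 \<le> l i"
      and leq: "\<And>x. c (P x) = (\<Sum>i\<in>I. l i * a i (P x))" by blast
    \<comment> \<open>Substituting \<open>P x = x - a n x * d\<close> into the identity for
      \<open>c (P x)\<close> collects exactly this coefficient in front of
      \<open>a n x\<close>.\<close>
    define m where "m = c d - (\<Sum>i\<in>I. l i * a i d)"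
    have "0 \<le> m"
    proof -
      have "(\<Sum>i\<in>I. l i * a i d) \<le> 0"
        using l d by (intro sum_nonpos) (simp add: mult_nonneg_nonpos)
      then show ?thesis using d by (simp add: m_def)
    qed
    have "c x = (\<Sum>i\<in>insert n I. (l(n := m)) i * a i x)" for x
    proof -
      have "(\<Sum>i\<in>I. (l(n := m)) i * a i x) = (\<Sum>i\<in>I. l i * a i x)"
        using insert.hyps by (intro sum.cong) auto
      moreover have "c x - a n x * c d = (\<Sum>i\<in>I. l i * (a i x - a n x * a i d))"
        using leq[of x] insert.prems(1,2) by (simp add: P_eq)
      moreover have "(\<Sum>i\<in>I. l i * (a i x - a n x * a i d))
          = (\<Sum>i\<in>I. l i * a i x) - a n x * (\<Sum>i\<in>I. l i * a i d)"
        by (simp add: sum_distrib_left sum_subtractf algebra_simps)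
      ultimately show ?thesis using insert.hyps by (simp add: m_def algebra_simps)
    qed
    then show ?thesis using l \<open>0 \<le> m\<close> by (intro exI[of _ "l(n := m)"]) auto
  qed
qed

text \<open>Sign restrictions enter as additional forms \<open>- x k\<close>. Discarding their
  nonnegative multipliers turns the Farkas identity into an inequality on nonnegative
  vectors.\<close>

lemma farkas_nonneg:
  fixes a :: "'i \<Rightarrow> ('k \<Rightarrow> real) \<Rightarrow> real"
  assumes "finite I" "finite K"
    and lin: "\<And>i. i \<in> I \<Longrightarrow> linear_form (a i)" "linear_form c"
    and imp: "\<And>x. (\<And>k. k \<in> K \<Longrightarrow> 0 \<le> x k) \<Longrightarrow> (\<And>i. i \<in> I \<Longrightarrow> a i x \<le> 0) \<Longrightarrow> c x \<le> 0"
  shows "\<exists>l. (\<forall>i\<in>I. 0 \<le> l i) \<and>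
    (\<forall>x. (\<forall>k\<in>K. 0 \<le> x k) \<longrightarrow> c x \<le> (\<Sum>i\<in>I. l i * a i x))"
proof -
  define g where "g = case_sum a (\<lambda>k x. - x k)"
  have "\<exists>l. (\<forall>i\<in>I <+> K. 0 \<le> l i) \<and> (\<forall>x. c x = (\<Sum>i\<in>I <+> K. l i * g i x))"
  proof (rule farkas)
    show "linear_form (g i)" if "i \<in> I <+> K" for i
      using that lin(1) by (auto simp: g_def linear_form_def)
    show "c x \<le> 0" if *: "\<And>i. i \<in> I <+> K \<Longrightarrow> g i x \<le> 0" for x
      using imp *[OF InlI] *[OF InrI] by (simp add: g_def)
  qed (use assms in auto)
  then obtain l where l: "\<forall>i\<in>I <+> K. 0 \<le> l i" "\<And>x. c x = (\<Sum>i\<in>I <+> K. l i * g i x)"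
    by blast
  have "c x \<le> (\<Sum>i\<in>I. l (Inl i) * a i x)" if "\<forall>k\<in>K. 0 \<le> x k" for x
  proof -
    have "c x = (\<Sum>i\<in>I. l (Inl i) * a i x) - (\<Sum>k\<in>K. l (Inr k) * x k)"
      unfolding l(2) using assms(1,2) by (simp add: sum.Plus g_def sum_negf)
    moreover have "0 \<le> (\<Sum>k\<in>K. l (Inr k) * x k)"
      using that l(1) by (intro sum_nonneg mult_nonneg_nonneg) auto
    ultimately show ?thesis by simp
  qed
  then show ?thesis using l(1) by (intro exI[of _ "\<lambda>i. l (Inl i)"]) auto
qed

section \<open>Duality for generalized flows\<close>

lemma net_flow_add_scale:
  "net_flow G \<gamma> (\<lambda>e. f e + s * g e) v = net_flow G \<gamma> f v + s * net_flow G \<gamma> g v"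
  by (simp add: net_flow_def sum.distrib sum_distrib_left algebra_simps)

lemma net_flow_scale: "net_flow G \<gamma> (\<lambda>e. s * f e) v = s * net_flow G \<gamma> f v"
  by (simp add: net_flow_def sum_distrib_left algebra_simps)

text \<open>Regrouping by arcs: each arc is counted once at its head, with its gain, and once at its
  tail.\<close>

lemma (in fin_digraph) sum_potential_net_flow:
  "(\<Sum>v\<in>verts G. \<pi> v * net_flow G \<gamma> f v) =
   (\<Sum>e\<in>arcs G. f e * (\<gamma> e * \<pi> (head G e) - \<pi> (tail G e)))"
proof -
  have "(\<Sum>v\<in>verts G. \<pi> v * (\<Sum>e\<in>in_arcs G v. \<gamma> e * f e))
      = (\<Sum>v\<in>verts G. \<Sum>e | e \<in> arcs G \<and> head G e = v. f e * (\<gamma> e * \<pi> (head G e)))"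
    by (auto simp: in_arcs_def sum_distrib_left intro!: sum.cong)
  also have "\<dots> = (\<Sum>e\<in>arcs G. f e * (\<gamma> e * \<pi> (head G e)))"
    by (rule sum.group) auto
  finally have 1: "(\<Sum>v\<in>verts G. \<pi> v * (\<Sum>e\<in>in_arcs G v. \<gamma> e * f e)) = \<dots>" .
  have "(\<Sum>v\<in>verts G. \<pi> v * (\<Sum>e\<in>out_arcs G v. f e))
      = (\<Sum>v\<in>verts G. \<Sum>e | e \<in> arcs G \<and> tail G e = v. f e * \<pi> (tail G e))"
    by (auto simp: out_arcs_def sum_distrib_left intro!: sum.cong)
  also have "\<dots> = (\<Sum>e\<in>arcs G. f e * \<pi> (tail G e))"
    by (rule sum.group) auto
  finally have 2: "(\<Sum>v\<in>verts G. \<pi> v * (\<Sum>e\<in>out_arcs G v. f e)) = \<dots>" .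
  show ?thesis
    using 1 2 by (simp add: net_flow_def right_diff_distrib sum_subtractf)
qed

section \<open>Linear programming duality in a fixed flow instance\<close>

context gen_flow_instance
begin

text \<open>
  For arcs of infinite capacity \<open>real_of_ereal (h e) = 0\<close>; the corresponding dual
  constraint is the second conjunct of \<open>dual_feasible\<close>.
\<close>

definition dual_cost :: "('v \<Rightarrow> real) \<Rightarrow> real" where
  "dual_cost \<pi> = (\<Sum>e\<in>arcs G. real_of_ereal (h e) * max 0 (\<gamma> e * \<pi> (head G e) - \<pi> (tail G e)))"

definition dual_feasible :: "('v \<Rightarrow> real) \<Rightarrow> bool" where
  "dual_feasible \<pi> \<longleftrightarrow> (\<forall>v\<in>verts G. 0 \<le> \<pi> v) \<and>
    (\<forall>e\<in>arcs G. h e = \<infinity> \<longrightarrow> \<gamma> e * \<pi> (head G e) \<le> \<pi> (tail G e))"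

abbreviation feasible :: "('v \<Rightarrow> real) \<Rightarrow> ('e \<Rightarrow> real) \<Rightarrow> bool" where
  "feasible x f \<equiv> f \<in> feasible_flows G t S h \<gamma> x"

lemma supply_verts: "S \<subseteq> verts G" "t \<notin> S" "finite S"
  using supply_subset finite_verts by (auto intro: finite_subset)

lemma real_capacity_nonneg: "e \<in> arcs G \<Longrightarrow> 0 \<le> real_of_ereal (h e)"
  using capacity_nonneg by (simp add: real_of_ereal_pos)

text \<open>Weight the vertex constraints by \<open>\<pi>\<close> and regroup by arcs. On an arc of
  finite capacity the flow earns at most capacity times the positive part of
  \<open>\<gamma> e * \<pi> (head G e) - \<pi> (tail G e)\<close>; on an infinite arc this
  difference is nonpositive.\<close>

lemma weak_duality:
  assumes \<pi>: "dual_feasible \<pi>" and f: "feasible x f"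
  shows "\<pi> t * net_flow G \<gamma> f t \<le> dual_cost \<pi> + (\<Sum>v\<in>S. \<pi> v * x v)"
proof -
  have t: "t \<in> verts G" using sink_in_verts .
  have "(\<Sum>v\<in>S. \<pi> v * (- x v)) \<le> (\<Sum>v\<in>S. \<pi> v * net_flow G \<gamma> f v)"
    using \<pi> f supply_verts by (intro sum_mono mult_left_mono)
      (auto simp: dual_feasible_def feasible_flows_def)
  moreover have "0 \<le> (\<Sum>v\<in>verts G - (S \<union> {t}). \<pi> v * net_flow G \<gamma> f v)"
    using \<pi> f by (intro sum_nonneg mult_nonneg_nonneg)
      (auto simp: dual_feasible_def feasible_flows_def)
  moreover have "(\<Sum>v\<in>verts G. \<pi> v * net_flow G \<gamma> f v) =
      (\<Sum>v\<in>verts G - (S \<union> {t}). \<pi> v * net_flow G \<gamma> f v)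
      + ((\<Sum>v\<in>S. \<pi> v * net_flow G \<gamma> f v) + \<pi> t * net_flow G \<gamma> f t)"
    using supply_verts t finite_verts
    by (subst sum.subset_diff[of "S \<union> {t}"]) auto
  moreover have "(\<Sum>e\<in>arcs G. f e * (\<gamma> e * \<pi> (head G e) - \<pi> (tail G e))) \<le> dual_cost \<pi>"
    unfolding dual_cost_def
  proof (rule sum_mono)
    fix e assume e: "e \<in> arcs G"
    let ?d = "\<gamma> e * \<pi> (head G e) - \<pi> (tail G e)"
    have fe: "0 \<le> f e" "ereal (f e) \<le> h e" using f e by (auto simp: feasible_flows_def)
    show "f e * ?d \<le> real_of_ereal (h e) * max 0 ?d"
    proof (cases "h e = \<infinity>")
      case True
      then have "?d \<le> 0" using \<pi> e by (auto simp: dual_feasible_def)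
      then show ?thesis using fe True by (simp add: mult_nonneg_nonpos)
    next
      case False
      then have "f e \<le> real_of_ereal (h e)"
        using fe by (cases "h e") auto
      then have "f e * max 0 ?d \<le> real_of_ereal (h e) * max 0 ?d"
        by (intro mult_right_mono) auto
      moreover have "f e * ?d \<le> f e * max 0 ?d" using fe by (intro mult_left_mono) auto
      ultimately show ?thesis by linarith
    qed
  qed
  ultimately show ?thesis
    unfolding sum_potential_net_flow by (simp add: sum_negf)
qed

text \<open>
  Every dual constraint bounds a positive multiple of one potential by another one; this
  makes the dual feasible region a lattice and the dual cost submodular.
\<close>

lemma dual_lattice:
  assumes "dual_feasible \<pi>" "dual_feasible \<rho>"
  shows "dual_feasible (\<lambda>v. min (\<pi> v) (\<rho> v))" "dual_feasible (\<lambda>v. max (\<pi> v) (\<rho> v))"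
    and "dual_cost (\<lambda>v. min (\<pi> v) (\<rho> v)) + dual_cost (\<lambda>v. max (\<pi> v) (\<rho> v))
      \<le> dual_cost \<pi> + dual_cost \<rho>"
proof -
  have scale: "g * min a b = min (g * a) (g * b)" "g * max a b = max (g * a) (g * b)"
    if "0 < g" for g a b :: real
    using that by (auto simp: min_def max_def)
  show "dual_feasible (\<lambda>v. min (\<pi> v) (\<rho> v))"
    using assms gain_pos unfolding dual_feasible_def by (auto simp: scale min_le_iff_disj)
  show "dual_feasible (\<lambda>v. max (\<pi> v) (\<rho> v))"
    using assms gain_pos unfolding dual_feasible_def
    by (auto simp: scale intro: max.coboundedI1 max.coboundedI2)
  \<comment> \<open>Submodularity of a single arc term: \<open>a\<close>, \<open>b\<close> stand for
    the scaled head potentials and \<open>c\<close>, \<open>d\<close> for the tail potentials of the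
    two dual solutions.\<close>
  have sub: "max 0 (min a b - min c d) + max 0 (max a b - max c d) \<le> max 0 (a - c) + max 0 (b - d)"
    for a b c d :: real by (auto simp: min_def max_def)
  show "dual_cost (\<lambda>v. min (\<pi> v) (\<rho> v)) + dual_cost (\<lambda>v. max (\<pi> v) (\<rho> v))
      \<le> dual_cost \<pi> + dual_cost \<rho>"
    unfolding dual_cost_def sum.distrib[symmetric]
  proof (rule sum_mono, unfold distrib_left[symmetric], rule mult_left_mono)
    fix e assume e: "e \<in> arcs G"
    show "0 \<le> real_of_ereal (h e)" using real_capacity_nonneg e .
  qed (simp add: scale gain_pos sub)
qed

text \<open>The variable \<open>\<tau>\<close> homogenizes the flow constraints, so that flow,
  supply and \<open>\<tau>\<close> range over a cone and Farkas' lemma applies. The vertex set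
  \<open>W\<close> and the demands \<open>d\<close> are left open because the lemma serves both a
  profit bound, where the sink is unconstrained, and a cost bound, where the sink must receive a
  prescribed value.\<close>

lemma flow_farkas:
  fixes c :: "('e \<Rightarrow> real) \<Rightarrow> ('v \<Rightarrow> real) \<Rightarrow> real \<Rightarrow> real"
  assumes W: "W \<subseteq> verts G"
    and lin: "\<And>f f' x x' \<tau> \<tau>' s. c (\<lambda>e. f e + s * f' e) (\<lambda>v. x v + s * x' v) (\<tau> + s * \<tau>')
      = c f x \<tau> + s * c f' x' \<tau>'"
    and imp: "\<And>f x \<tau>. (\<And>e. e \<in> arcs G \<Longrightarrow> 0 \<le> f e) \<Longrightarrow> x \<in> S \<rightarrow> {0..} \<Longrightarrow> 0 \<le> \<tau> \<Longrightarrow>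
      (\<And>e. e \<in> arcs G \<Longrightarrow> h e \<noteq> \<infinity> \<Longrightarrow> f e \<le> real_of_ereal (h e) * \<tau>) \<Longrightarrow>
      (\<And>v. v \<in> W \<Longrightarrow> d v * \<tau> \<le> net_flow G \<gamma> f v + (if v \<in> S then x v else 0)) \<Longrightarrow> c f x \<tau> \<le> 0"
  obtains \<beta> \<pi> where "\<And>e. e \<in> arcs G \<Longrightarrow> 0 \<le> \<beta> e" "\<And>e. h e = \<infinity> \<Longrightarrow> \<beta> e = 0"
    "\<And>v. v \<in> W \<Longrightarrow> 0 \<le> \<pi> v"
    "\<And>f x \<tau>. (\<And>e. e \<in> arcs G \<Longrightarrow> 0 \<le> f e) \<Longrightarrow> x \<in> S \<rightarrow> {0..} \<Longrightarrow> 0 \<le> \<tau> \<Longrightarrow>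
      c f x \<tau> \<le> (\<Sum>e\<in>arcs G. \<beta> e * (f e - real_of_ereal (h e) * \<tau>))
        + (\<Sum>v\<in>W. \<pi> v * (d v * \<tau> - net_flow G \<gamma> f v - (if v \<in> S then x v else 0)))"
proof -
  define E where "E = {e \<in> arcs G. h e \<noteq> \<infinity>}"
  \<comment> \<open>All variables are packed into one vector: index \<open>None\<close> holds
    \<open>\<tau>\<close>, \<open>Some (Inl e)\<close> the flow on \<open>e\<close>,
    \<open>Some (Inr v)\<close> the supply at \<open>v\<close>. Only arcs in \<open>E\<close> get a
    capacity row, hence \<open>\<beta> e = 0\<close> on infinite arcs.\<close>
  define K where "K = insert None ((\<lambda>e. Some (Inl e)) ` arcs G \<union> (\<lambda>v. Some (Inr v)) ` S)"
  define F where "F = (\<lambda>(X :: ('e + 'v) option \<Rightarrow> real) e. X (Some (Inl e)))"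
  define Z where "Z = (\<lambda>(X :: ('e + 'v) option \<Rightarrow> real) v. X (Some (Inr v)))"
  define a where "a = case_sum (\<lambda>e X. F X e - real_of_ereal (h e) * X None)
    (\<lambda>v X. d v * X None - net_flow G \<gamma> (F X) v - (if v \<in> S then Z X v else 0))"
  have FZ_lin: "F (\<lambda>k. X k + s * Y k) = (\<lambda>e. F X e + s * F Y e)"
      "Z (\<lambda>k. X k + s * Y k) = (\<lambda>v. Z X v + s * Z Y v)" for X Y s
    by (simp_all add: F_def Z_def)
  have finW: "finite W" using W finite_verts by (rule finite_subset)
  have "\<exists>l. (\<forall>i\<in>E <+> W. 0 \<le> l i) \<and>
    (\<forall>X. (\<forall>k\<in>K. 0 \<le> X k) \<longrightarrow> c (F X) (Z X) (X None) \<le> (\<Sum>i\<in>E <+> W. l i * a i X))"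
  proof (rule farkas_nonneg)
    show "finite (E <+> W)" "finite K"
      using finW supply_verts by (auto simp: E_def K_def)
    show "linear_form (a i)" if "i \<in> E <+> W" for i
      using that by (cases i)
        (auto simp: a_def linear_form_def FZ_lin net_flow_add_scale algebra_simps)
    show "linear_form (\<lambda>X. c (F X) (Z X) (X None))"
      by (simp add: linear_form_def FZ_lin lin)
    show "c (F X) (Z X) (X None) \<le> 0"
      if X: "\<And>k. k \<in> K \<Longrightarrow> 0 \<le> X k" and aX: "\<And>i. i \<in> E <+> W \<Longrightarrow> a i X \<le> 0" for X
    proof (rule imp)
      show "0 \<le> F X e" if "e \<in> arcs G" for e
        using X that by (simp add: F_def K_def)
      show "Z X \<in> S \<rightarrow> {0..}"
        using X by (auto simp: Z_def K_def)
      show "0 \<le> X None" using X by (simp add: K_def)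
      show "F X e \<le> real_of_ereal (h e) * X None" if "e \<in> arcs G" "h e \<noteq> \<infinity>" for e
        using aX[of "Inl e"] that by (simp add: a_def E_def InlI)
      show "d v * X None \<le> net_flow G \<gamma> (F X) v + (if v \<in> S then Z X v else 0)" if "v \<in> W" for v
        using aX[of "Inr v"] that by (simp add: a_def InrI)
    qed
  qed
  then obtain l where l: "\<forall>i\<in>E <+> W. 0 \<le> l i"
    and le: "\<And>X. (\<forall>k\<in>K. 0 \<le> X k) \<Longrightarrow> c (F X) (Z X) (X None) \<le> (\<Sum>i\<in>E <+> W. l i * a i X)"
    by blast
  define \<beta> where "\<beta> = (\<lambda>e. if h e = \<infinity> then 0 else l (Inl e))"
  show thesis
  proof (rule that[of \<beta> "\<lambda>v. l (Inr v)"])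
    show "0 \<le> \<beta> e" if "e \<in> arcs G" for e
      using l that by (auto simp: \<beta>_def E_def)
    show "\<beta> e = 0" if "h e = \<infinity>" for e using that by (simp add: \<beta>_def)
    show "0 \<le> l (Inr v)" if "v \<in> W" for v using l that by auto
    fix f :: "'e \<Rightarrow> real" and x :: "'v \<Rightarrow> real" and \<tau> :: real
    assume *: "\<And>e. e \<in> arcs G \<Longrightarrow> 0 \<le> f e" "x \<in> S \<rightarrow> {0..}" "0 \<le> \<tau>"
    define X where "X = case_option \<tau> (case_sum f x)"
    have X: "F X = f" "Z X = x" "X None = \<tau>" by (auto simp: X_def F_def Z_def)
    have "\<forall>k\<in>K. 0 \<le> X k"
      using * by (auto simp: K_def X_def)
    from le[OF this] have "c f x \<tau> \<le> (\<Sum>e\<in>E. l (Inl e) * (f e - real_of_ereal (h e) * \<tau>))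
        + (\<Sum>v\<in>W. l (Inr v) * (d v * \<tau> - net_flow G \<gamma> f v - (if v \<in> S then x v else 0)))"
      using finW by (simp add: sum.Plus E_def a_def X cong: if_cong)
    also have "(\<Sum>e\<in>E. l (Inl e) * (f e - real_of_ereal (h e) * \<tau>))
        = (\<Sum>e\<in>arcs G. \<beta> e * (f e - real_of_ereal (h e) * \<tau>))"
      by (rule sum.mono_neutral_cong_left) (auto simp: E_def \<beta>_def)
    finally show "c f x \<tau> \<le> (\<Sum>e\<in>arcs G. \<beta> e * (f e - real_of_ereal (h e) * \<tau>))
        + (\<Sum>v\<in>W. l (Inr v) * (d v * \<tau> - net_flow G \<gamma> f v - (if v \<in> S then x v else 0)))" .
  qed
qed

text \<open>Passage from the cone back to flows. Since capacities are nonnegative, division by any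
  \<open>T \<ge> \<tau>\<close> works, which keeps the case \<open>\<tau> = 0\<close>
  accessible.\<close>

lemma feasible_scale:
  assumes "\<And>e. e \<in> arcs G \<Longrightarrow> 0 \<le> f e" "0 \<le> \<tau>" "\<tau> \<le> T" "0 < T"
    and "\<And>e. e \<in> arcs G \<Longrightarrow> h e \<noteq> \<infinity> \<Longrightarrow> f e \<le> real_of_ereal (h e) * \<tau>"
    and "\<And>v. v \<in> verts G - {t} \<Longrightarrow> 0 \<le> net_flow G \<gamma> f v + (if v \<in> S then x v else 0)"
  shows "feasible (\<lambda>v. inverse T * x v) (\<lambda>e. inverse T * f e)"
proof -
  have "ereal (inverse T * f e) \<le> h e" if e: "e \<in> arcs G" for e
  proof (cases "h e")
    case (real H)
    have "f e \<le> H * \<tau>" using assms(5)[OF e] real by simp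
    also have "\<dots> \<le> H * T"
      using assms(3) capacity_nonneg[OF e] real by (intro mult_left_mono) auto
    finally show ?thesis using real assms(4) by (simp add: field_simps)
  qed (use capacity_nonneg[OF e] in auto)
  moreover have "- (inverse T * x v) \<le> inverse T * net_flow G \<gamma> f v" if "v \<in> S" for v
  proof -
    have "v \<in> verts G - {t}" using that supply_subset by auto
    from assms(6)[OF this] have "- x v \<le> net_flow G \<gamma> f v" using that by simp
    then have "inverse T * - x v \<le> inverse T * net_flow G \<gamma> f v"
      using assms(4) by (intro mult_left_mono) auto
    then show ?thesis by simp
  qed
  moreover have "0 \<le> inverse T * net_flow G \<gamma> f v" if "v \<in> verts G - (S \<union> {t})" for v
    using assms(4) assms(6)[of v] that by simp
  ultimately show ?thesis
    using assms(1,4) by (simp add: feasible_flows_def net_flow_scale)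
qed

text \<open>An upper bound \<open>X\<close> on profit becomes a linear inequality on the homogenized
  cone. Testing the resulting Farkas inequality on unit vectors recovers the dual constraints one by
  one, with the prices \<open>p\<close> as upper bounds for the potentials of supply
  vertices.\<close>

lemma strong_duality:
  assumes r: "0 \<le> r"
    and bound: "\<And>x f. x \<in> S \<rightarrow> {0..} \<Longrightarrow> feasible x f \<Longrightarrow>
      r * net_flow G \<gamma> f t - (\<Sum>v\<in>S. p v * x v) \<le> X"
  obtains \<pi> where "dual_feasible \<pi>" "\<pi> t = r" "\<And>v. v \<in> S \<Longrightarrow> \<pi> v \<le> p v" "dual_cost \<pi> \<le> X"
proof -
  define W where "W = verts G - {t}"
  define c where "c = (\<lambda>f x \<tau>. r * net_flow G \<gamma> f t - (\<Sum>v\<in>S. p v * x v) - X * \<tau>)"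
  have "W \<subseteq> verts G" by (auto simp: W_def)
  moreover have "c (\<lambda>e. f e + s * f' e) (\<lambda>v. x v + s * x' v) (\<tau> + s * \<tau>')
      = c f x \<tau> + s * c f' x' \<tau>'" for f f' x x' \<tau> \<tau>' s
    by (simp add: c_def net_flow_add_scale sum.distrib sum_distrib_left algebra_simps)
  moreover have "c f x \<tau> \<le> 0"
    if f: "\<And>e. e \<in> arcs G \<Longrightarrow> 0 \<le> f e" "x \<in> S \<rightarrow> {0..}" "0 \<le> \<tau>"
      "\<And>e. e \<in> arcs G \<Longrightarrow> h e \<noteq> \<infinity> \<Longrightarrow> f e \<le> real_of_ereal (h e) * \<tau>"
      "\<And>v. v \<in> W \<Longrightarrow> 0 * \<tau> \<le> net_flow G \<gamma> f v + (if v \<in> S then x v else 0)" for f x \<tau>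
  proof -
    \<comment> \<open>As \<open>\<tau>\<close> may vanish, rescaling is done by
      \<open>T > \<tau>\<close>, followed by the limit as \<open>T\<close> decreases to
      \<open>\<tau>\<close>.\<close>
    have "r * net_flow G \<gamma> f t - (\<Sum>v\<in>S. p v * x v) \<le> X * T" if "\<tau> < T" for T
    proof -
      have T: "\<tau> \<le> T" "0 < T" using that f(3) by auto
      have "feasible (\<lambda>v. inverse T * x v) (\<lambda>e. inverse T * f e)"
        using f by (intro feasible_scale[OF f(1,3) T]) (auto simp: W_def)
      moreover have "(\<lambda>v. inverse T * x v) \<in> S \<rightarrow> {0..}" using f(2) T by (auto simp: Pi_iff)
      ultimately have "r * (inverse T * net_flow G \<gamma> f t) - (\<Sum>v\<in>S. p v * (inverse T * x v)) \<le> X"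
        using bound by (metis net_flow_scale)
      moreover have "(\<Sum>v\<in>S. p v * (inverse T * x v)) = inverse T * (\<Sum>v\<in>S. p v * x v)"
        by (simp add: sum_distrib_left algebra_simps)
      ultimately have "inverse T * (r * net_flow G \<gamma> f t - (\<Sum>v\<in>S. p v * x v)) \<le> X"
        by (simp add: algebra_simps)
      then show ?thesis using T(2) by (simp add: field_simps)
    qed
    then have "\<forall>\<^sub>F T in at_right \<tau>. r * net_flow G \<gamma> f t - (\<Sum>v\<in>S. p v * x v) \<le> X * T"
      by (simp add: eventually_at_right_less eventually_mono[OF eventually_at_right_less])
    moreover have "((\<lambda>T. X * T) \<longlongrightarrow> X * \<tau>) (at_right \<tau>)" by (intro tendsto_intros)
    ultimately have "r * net_flow G \<gamma> f t - (\<Sum>v\<in>S. p v * x v) \<le> X * \<tau>"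
      by (intro tendsto_lowerbound[of "\<lambda>T. X * T" _ "at_right \<tau>"]) auto
    then show ?thesis by (simp add: c_def)
  qed
  ultimately obtain \<beta> \<pi> where \<beta>: "\<And>e. e \<in> arcs G \<Longrightarrow> 0 \<le> \<beta> e" "\<And>e. h e = \<infinity> \<Longrightarrow> \<beta> e = 0"
    and \<pi>: "\<And>v. v \<in> W \<Longrightarrow> 0 \<le> \<pi> v"
    and le: "\<And>f x \<tau>. (\<And>e. e \<in> arcs G \<Longrightarrow> 0 \<le> f e) \<Longrightarrow> x \<in> S \<rightarrow> {0..} \<Longrightarrow> 0 \<le> \<tau> \<Longrightarrow>
      c f x \<tau> \<le> (\<Sum>e\<in>arcs G. \<beta> e * (f e - real_of_ereal (h e) * \<tau>))
        + (\<Sum>v\<in>W. \<pi> v * (0 * \<tau> - net_flow G \<gamma> f v - (if v \<in> S then x v else 0)))"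
    by (rule flow_farkas[of W c "\<lambda>_. 0"]) blast+
  \<comment> \<open>The objective weight \<open>r\<close> acts as the potential of the sink, which
    \<open>W\<close> leaves out.\<close>
  define \<rho> where "\<rho> = \<pi>(t := r)"
  have net0: "net_flow G \<gamma> (\<lambda>_. 0) v = 0" for v by (simp add: net_flow_def)
  \<comment> \<open>Tested on a unit of flow along \<open>e\<close> with zero supply and
    \<open>\<tau> = 0\<close>.\<close>
  have arc: "\<gamma> e * \<rho> (head G e) - \<rho> (tail G e) \<le> \<beta> e" if e: "e \<in> arcs G" for e
  proof -
    let ?f = "\<lambda>e'. if e' = e then 1 else 0 :: real"
    have "(\<Sum>e'\<in>arcs G. \<beta> e' * (?f e' - real_of_ereal (h e') * 0))
        = (\<Sum>e'\<in>arcs G. if e' = e then \<beta> e else 0)"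
      by (intro sum.cong) auto
    then have "r * net_flow G \<gamma> ?f t \<le> \<beta> e - (\<Sum>v\<in>W. \<pi> v * net_flow G \<gamma> ?f v)"
      using le[of ?f "\<lambda>_. 0" 0] e by (simp add: c_def sum_negf)
    moreover have "(\<Sum>v\<in>verts G. \<rho> v * net_flow G \<gamma> ?f v)
        = r * net_flow G \<gamma> ?f t + (\<Sum>v\<in>W. \<pi> v * net_flow G \<gamma> ?f v)"
      by (simp add: W_def \<rho>_def sum.remove[OF finite_verts sink_in_verts])
    moreover have "(\<Sum>v\<in>verts G. \<rho> v * net_flow G \<gamma> ?f v)
        = \<gamma> e * \<rho> (head G e) - \<rho> (tail G e)"
      unfolding sum_potential_net_flow using e by (simp add: if_distrib[of "\<lambda>x. x * _"] cong: if_cong)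
    ultimately show ?thesis by linarith
  qed
  show thesis
  proof (rule that[of \<rho>])
    show "\<rho> t = r" by (simp add: \<rho>_def)
    show "dual_feasible \<rho>"
      using \<pi> r arc \<beta>(2) by (fastforce simp: dual_feasible_def \<rho>_def W_def)
    show "\<rho> v \<le> p v" if v: "v \<in> S" for v
    proof -
      \<comment> \<open>Tested on a unit of supply at \<open>v\<close> with zero flow and
        \<open>\<tau> = 0\<close>.\<close>
      let ?x = "\<lambda>w. if w = v then 1 else 0 :: real"
      have "v \<in> W" "v \<noteq> t" using v supply_verts by (auto simp: W_def)
      moreover have "finite W" by (simp add: W_def)
      moreover have "(\<Sum>w\<in>W. \<pi> w * (0 * 0 - net_flow G \<gamma> (\<lambda>_. 0) w - (if w \<in> S then ?x w else 0)))
        = (\<Sum>w\<in>W. if w = v then - \<pi> v else 0)"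
        using v by (intro sum.cong) (auto simp: net0)
      moreover have "c (\<lambda>_. 0) ?x 0 = - p v"
        using v supply_verts by (simp add: c_def net0 if_distrib[of "\<lambda>x. _ * x"] cong: if_cong)
      ultimately show ?thesis
        using le[of "\<lambda>_. 0" ?x 0] by (simp add: \<rho>_def)
    qed
    \<comment> \<open>By \<open>arc\<close>, each \<open>\<beta> e\<close> dominates the positive
      part occurring in the dual cost. Testing on zero flow, zero supply and
      \<open>\<tau> = 1\<close> bounds the total by \<open>X\<close>.\<close>
    have "dual_cost \<rho> \<le> (\<Sum>e\<in>arcs G. real_of_ereal (h e) * \<beta> e)"
      unfolding dual_cost_def using arc \<beta>(1) real_capacity_nonneg
      by (intro sum_mono mult_left_mono) auto
    also have "\<dots> \<le> X"
      using le[of "\<lambda>_. 0" "\<lambda>_. 0" 1] by (simp add: c_def net0 sum_negf algebra_simps)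
    finally show "dual_cost \<rho> \<le> X" .
  qed
qed

text \<open>The multiplier of the requirement that the sink receive \<open>w\<close> is the sink
  potential in the Farkas certificate. Going through Farkas' lemma covers the case where
  \<open>w\<close> is the largest attainable value and no strictly feasible point exists.\<close>

lemma min_cost_multiplier:
  assumes p: "p \<in> S \<rightarrow> {0..}"
    and bound: "\<And>x f. x \<in> S \<rightarrow> {0..} \<Longrightarrow> feasible x f \<Longrightarrow> w \<le> net_flow G \<gamma> f t \<Longrightarrow>
      c \<le> (\<Sum>v\<in>S. p v * x v)"
  obtains r where "0 \<le> r"
    "\<And>x f. x \<in> S \<rightarrow> {0..} \<Longrightarrow> feasible x f \<Longrightarrow>
      c + r * (net_flow G \<gamma> f t - w) \<le> (\<Sum>v\<in>S. p v * x v)"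
proof -
  define C where "C = (\<lambda>(f :: 'e \<Rightarrow> real) x \<tau>. c * \<tau> - (\<Sum>v\<in>S. p v * x v))"
  define d where "d = (\<lambda>v. if v = t then w else 0)"
  have tS: "t \<notin> S" "t \<in> verts G" using supply_verts sink_in_verts by auto
  have "verts G \<subseteq> verts G" by simp
  moreover have "C (\<lambda>e. f e + s * f' e) (\<lambda>v. x v + s * x' v) (\<tau> + s * \<tau>')
      = C f x \<tau> + s * C f' x' \<tau>'" for f f' x x' \<tau> \<tau>' s
    by (simp add: C_def sum.distrib sum_distrib_left algebra_simps)
  moreover have "C f x \<tau> \<le> 0"
    if f: "\<And>e. e \<in> arcs G \<Longrightarrow> 0 \<le> f e" "x \<in> S \<rightarrow> {0..}" "0 \<le> \<tau>"
      "\<And>e. e \<in> arcs G \<Longrightarrow> h e \<noteq> \<infinity> \<Longrightarrow> f e \<le> real_of_ereal (h e) * \<tau>"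
      "\<And>v. v \<in> verts G \<Longrightarrow> d v * \<tau> \<le> net_flow G \<gamma> f v + (if v \<in> S then x v else 0)" for f x \<tau>
  proof (cases "\<tau> = 0")
    \<comment> \<open>At \<open>\<tau> = 0\<close> rescaling is impossible, but nonnegativity of
      prices already gives the sign.\<close>
    case True
    have "0 \<le> (\<Sum>v\<in>S. p v * x v)"
      using p f(2) by (intro sum_nonneg mult_nonneg_nonneg) auto
    then show ?thesis using True by (simp add: C_def)
  next
    case False
    then have T: "0 < \<tau>" using f(3) by simp
    have "feasible (\<lambda>v. inverse \<tau> * x v) (\<lambda>e. inverse \<tau> * f e)"
    proof (rule feasible_scale[OF f(1,3) order_refl T f(4)])
      show "0 \<le> net_flow G \<gamma> f v + (if v \<in> S then x v else 0)" if "v \<in> verts G - {t}" for v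
        using f(5)[of v] that by (simp add: d_def)
    qed
    moreover have "(\<lambda>v. inverse \<tau> * x v) \<in> S \<rightarrow> {0..}" using f(2) T by (auto simp: Pi_iff)
    moreover have "w \<le> net_flow G \<gamma> (\<lambda>e. inverse \<tau> * f e) t"
      unfolding net_flow_scale using f(5)[of t] T tS by (simp add: d_def field_simps)
    ultimately have "c \<le> (\<Sum>v\<in>S. p v * (inverse \<tau> * x v))" using bound by blast
    also have "\<dots> = inverse \<tau> * (\<Sum>v\<in>S. p v * x v)"
      by (simp add: sum_distrib_left algebra_simps)
    finally show ?thesis using T by (simp add: C_def field_simps)
  qed
  ultimately obtain \<beta> \<pi> where \<beta>: "\<And>e. e \<in> arcs G \<Longrightarrow> 0 \<le> \<beta> e" "\<And>e. h e = \<infinity> \<Longrightarrow> \<beta> e = 0"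
    and \<pi>: "\<And>v. v \<in> verts G \<Longrightarrow> 0 \<le> \<pi> v"
    and le: "\<And>f x \<tau>. (\<And>e. e \<in> arcs G \<Longrightarrow> 0 \<le> f e) \<Longrightarrow> x \<in> S \<rightarrow> {0..} \<Longrightarrow> 0 \<le> \<tau> \<Longrightarrow>
      C f x \<tau> \<le> (\<Sum>e\<in>arcs G. \<beta> e * (f e - real_of_ereal (h e) * \<tau>))
        + (\<Sum>v\<in>verts G. \<pi> v * (d v * \<tau> - net_flow G \<gamma> f v - (if v \<in> S then x v else 0)))"
    by (rule flow_farkas[of "verts G" C d]) blast+
  show thesis
  proof (rule that[of "\<pi> t"])
    show "0 \<le> \<pi> t" using \<pi> tS by simp
    fix x f assume x: "x \<in> S \<rightarrow> {0..}" and f: "feasible x f"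
    have "\<beta> e * (f e - real_of_ereal (h e)) \<le> 0" if e: "e \<in> arcs G" for e
    proof (cases "h e = \<infinity>")
      case False
      then have "f e \<le> real_of_ereal (h e)"
        using f e by (cases "h e") (auto simp: feasible_flows_def)
      then show ?thesis using \<beta>(1)[OF e] by (intro mult_nonneg_nonpos) auto
    qed (simp add: \<beta>(2))
    then have 1: "(\<Sum>e\<in>arcs G. \<beta> e * (f e - real_of_ereal (h e))) \<le> 0"
      by (rule sum_nonpos)
    have "\<pi> v * (d v - net_flow G \<gamma> f v - (if v \<in> S then x v else 0)) \<le> 0"
      if v: "v \<in> verts G - {t}" for v
      using \<pi>[of v] v f by (intro mult_nonneg_nonpos) (auto simp: feasible_flows_def d_def)
    then have 2: "(\<Sum>v\<in>verts G - {t}. \<pi> v * (d v - net_flow G \<gamma> f v - (if v \<in> S then x v else 0))) \<le> 0"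
      by (rule sum_nonpos)
    have "C f x 1 \<le> (\<Sum>e\<in>arcs G. \<beta> e * (f e - real_of_ereal (h e)))
        + (\<Sum>v\<in>verts G. \<pi> v * (d v - net_flow G \<gamma> f v - (if v \<in> S then x v else 0)))"
      using le[of f x 1] f x by (simp add: feasible_flows_def)
    also have "\<dots> \<le> \<pi> t * (w - net_flow G \<gamma> f t)"
      using 1 2 tS by (simp add: sum.remove[OF finite_verts tS(2)] d_def)
    finally show "c + \<pi> t * (net_flow G \<gamma> f t - w) \<le> (\<Sum>v\<in>S. p v * x v)"
      by (simp add: C_def algebra_simps)
  qed
qed

end

lemma (in gen_flow_instance) feasible_convex:
  assumes f: "feasible x f" and f': "feasible x' f'" and s: "0 \<le> s" "s \<le> 1"
  shows "feasible (\<lambda>v. (1 - s) * x v + s * x' v) (\<lambda>e. (1 - s) * f e + s * f' e)"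
proof -
  have net: "net_flow G \<gamma> (\<lambda>e. (1 - s) * f e + s * f' e) v
      = (1 - s) * net_flow G \<gamma> f v + s * net_flow G \<gamma> f' v" for v
    by (simp add: net_flow_add_scale net_flow_scale)
  have "ereal ((1 - s) * f e + s * f' e) \<le> h e" if "e \<in> arcs G" for e
  proof (cases "h e")
    case (real H)
    then have "f e \<le> H" "f' e \<le> H" using f f' that by (auto simp: feasible_flows_def)
    then show ?thesis using real s by (simp add: convex_bound_le)
  qed (use capacity_nonneg[OF that] in auto)
  moreover have "- ((1 - s) * x v + s * x' v)
      \<le> (1 - s) * net_flow G \<gamma> f v + s * net_flow G \<gamma> f' v" if "v \<in> S" for v
  proof -
    have "(1 - s) * - x v + s * - x' v \<le> (1 - s) * net_flow G \<gamma> f v + s * net_flow G \<gamma> f' v"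
      using f f' s that by (intro add_mono mult_left_mono) (auto simp: feasible_flows_def)
    then show ?thesis by simp
  qed
  ultimately show ?thesis
    using f f' s by (simp add: feasible_flows_def net)
qed

section \<open>Generalized network utilities\<close>

locale network_utility = gen_flow_instance G t "Inl ` M" h \<gamma>
  for G :: "('g + nat, nat) pre_digraph" (structure) and t and M :: "'g set" and h \<gamma> +
  fixes u :: "('g \<Rightarrow> real) \<Rightarrow> real"
  assumes max_flow:
    "z \<in> M \<rightarrow> {0..} \<Longrightarrow> is_max_flow_value G t (Inl ` M) h \<gamma> (case_sum z (\<lambda>_. 0)) (u z)"
begin

section \<open>From flow duality to statements about the utility function\<close>

lemma optimal_flow:
  assumes "z \<in> M \<rightarrow> {0..}"
  obtains f where "feasible (case_sum z (\<lambda>_. 0)) f" "net_flow G \<gamma> f t = u z"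
  using max_flow[OF assms] by (auto simp: is_max_flow_value_def is_arg_max_def)

lemma flow_le_utility:
  assumes "feasible x f" "x \<in> Inl ` M \<rightarrow> {0..}"
  shows "net_flow G \<gamma> f t \<le> u (\<lambda>j. x (Inl j))"
proof -
  have "feasible (case_sum (\<lambda>j. x (Inl j)) (\<lambda>_. 0)) f"
    using assms(1) by (auto simp: feasible_flows_def)
  moreover have "(\<lambda>j. x (Inl j)) \<in> M \<rightarrow> {0..}" using assms(2) by auto
  ultimately show ?thesis
    using max_flow[of "\<lambda>j. x (Inl j)"]
    by (fastforce simp: is_max_flow_value_def is_arg_max_def not_less)
qed

lemma sum_supply: "(\<Sum>v\<in>Inl ` M. case_sum p (\<lambda>_. 0) v * x v) = cost M p (\<lambda>j. x (Inl j))"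
  by (simp add: cost_def sum.reindex)

lemma concave:
  assumes "z \<in> M \<rightarrow> {0..}" "z' \<in> M \<rightarrow> {0..}" "0 \<le> s" "s \<le> 1"
  shows "(1 - s) * u z + s * u z' \<le> u (\<lambda>j. (1 - s) * z j + s * z' j)"
proof -
  obtain f f' where f: "feasible (case_sum z (\<lambda>_. 0)) f" "net_flow G \<gamma> f t = u z"
    and f': "feasible (case_sum z' (\<lambda>_. 0)) f'" "net_flow G \<gamma> f' t = u z'"
    using optimal_flow assms by metis
  show ?thesis
    using flow_le_utility[OF feasible_convex[OF f(1) f'(1) assms(3,4)]] assms f(2) f'(2)
    by (auto simp: net_flow_add_scale net_flow_scale Pi_iff)
qed

text \<open>\<open>X\<close> and \<open>Y\<close> stand for upper bounds on the suprema at
  \<open>(p, r)\<close> and \<open>(q, s)\<close>. Strong duality certifies them by potentials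
  \<open>\<pi>\<close> and \<open>\<rho>\<close>; the componentwise minimum and maximum are dual
  feasible for the minimum and maximum of the data, with no larger total cost. Weak duality then
  evaluates these at \<open>z\<close> and \<open>z'\<close>.\<close>

lemma submodular:
  assumes rs: "0 \<le> r" "0 \<le> s"
    and X: "\<And>z. z \<in> M \<rightarrow> {0..} \<Longrightarrow> r * u z - cost M p z \<le> X"
    and Y: "\<And>z. z \<in> M \<rightarrow> {0..} \<Longrightarrow> s * u z - cost M q z \<le> Y"
    and z: "z \<in> M \<rightarrow> {0..}" and z': "z' \<in> M \<rightarrow> {0..}"
  shows "(min r s * u z - cost M (\<lambda>j. min (p j) (q j)) z)
    + (max r s * u z' - cost M (\<lambda>j. max (p j) (q j)) z') \<le> X + Y"
proof -
  have dual: "\<exists>\<pi>. dual_feasible \<pi> \<and> \<pi> t = r \<and> (\<forall>j\<in>M. \<pi> (Inl j) \<le> p j) \<and> dual_cost \<pi> \<le> X"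
    if r: "0 \<le> r" and X: "\<And>z. z \<in> M \<rightarrow> {0..} \<Longrightarrow> r * u z - cost M p z \<le> X" for r p X
  proof -
    have "r * net_flow G \<gamma> f t - (\<Sum>v\<in>Inl ` M. case_sum p (\<lambda>_. 0) v * x v) \<le> X"
      if x: "x \<in> Inl ` M \<rightarrow> {0..}" "feasible x f" for x f
    proof -
      have "r * net_flow G \<gamma> f t \<le> r * u (\<lambda>j. x (Inl j))"
        using flow_le_utility[OF x(2,1)] r by (rule mult_left_mono)
      moreover have "r * u (\<lambda>j. x (Inl j)) - cost M p (\<lambda>j. x (Inl j)) \<le> X"
        using x(1) by (intro X) auto
      ultimately show ?thesis unfolding sum_supply by linarith
    qed
    from strong_duality[OF r this] obtain \<pi> where "dual_feasible \<pi>" "\<pi> t = r" "dual_cost \<pi> \<le> X"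
      "\<And>v. v \<in> Inl ` M \<Longrightarrow> \<pi> v \<le> case_sum p (\<lambda>_. 0) v" by blast
    then show ?thesis by (intro exI[of _ \<pi>]) force
  qed
  have weak: "\<pi> t * u z \<le> dual_cost \<pi> + cost M p z"
    if *: "dual_feasible \<pi>" "\<And>j. j \<in> M \<Longrightarrow> \<pi> (Inl j) \<le> p j" "z \<in> M \<rightarrow> {0..}" for \<pi> p z
  proof -
    obtain f where f: "feasible (case_sum z (\<lambda>_. 0)) f" "net_flow G \<gamma> f t = u z"
      using optimal_flow[OF *(3)] .
    have "\<pi> t * u z \<le> dual_cost \<pi> + (\<Sum>j\<in>M. \<pi> (Inl j) * z j)"
      using weak_duality[OF *(1) f(1)] f(2) by (simp add: sum.reindex)
    also have "(\<Sum>j\<in>M. \<pi> (Inl j) * z j) \<le> cost M p z"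
      unfolding cost_def using *(2,3) by (intro sum_mono mult_right_mono) auto
    finally show ?thesis by simp
  qed
  obtain \<pi> \<rho> where \<pi>: "dual_feasible \<pi>" "\<pi> t = r" "\<forall>j\<in>M. \<pi> (Inl j) \<le> p j" "dual_cost \<pi> \<le> X"
    and \<rho>: "dual_feasible \<rho>" "\<rho> t = s" "\<forall>j\<in>M. \<rho> (Inl j) \<le> q j" "dual_cost \<rho> \<le> Y"
    using dual[OF rs(1) X] dual[OF rs(2) Y] by auto
  note lat = dual_lattice[OF \<pi>(1) \<rho>(1)]
  have "min r s * u z \<le> dual_cost (\<lambda>v. min (\<pi> v) (\<rho> v)) + cost M (\<lambda>j. min (p j) (q j)) z"
    using weak[OF lat(1) _ z, of "\<lambda>j. min (p j) (q j)"] \<pi>(2,3) \<rho>(2,3)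
    by (simp add: min_le_iff_disj)
  moreover have "max r s * u z' \<le> dual_cost (\<lambda>v. max (\<pi> v) (\<rho> v)) + cost M (\<lambda>j. max (p j) (q j)) z'"
    using weak[OF lat(2) _ z', of "\<lambda>j. max (p j) (q j)"] \<pi>(2,3) \<rho>(2,3)
    by (simp add: max.coboundedI1 max.coboundedI2)
  ultimately show ?thesis using lat(3) \<pi>(4) \<rho>(4) by linarith
qed

text \<open>When \<open>c\<close> is the least expenditure for utility level \<open>w\<close>, the
  number \<open>r\<close> is a subgradient of the expenditure function at \<open>w\<close>.\<close>

lemma expenditure_multiplier:
  assumes p: "p \<in> M \<rightarrow> {0..}"
    and bound: "\<And>z. z \<in> M \<rightarrow> {0..} \<Longrightarrow> w \<le> u z \<Longrightarrow> c \<le> cost M p z"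
  shows "\<exists>r\<ge>0. \<forall>z\<in>M \<rightarrow> {0..}. c + r * (u z - w) \<le> cost M p z"
proof -
  have flow_bound: "c \<le> (\<Sum>v\<in>Inl ` M. case_sum p (\<lambda>_. 0) v * x v)"
    if x: "x \<in> Inl ` M \<rightarrow> {0..}" "feasible x f" "w \<le> net_flow G \<gamma> f t" for x f
  proof -
    have "w \<le> u (\<lambda>j. x (Inl j))" using flow_le_utility[OF x(2,1)] x(3) by linarith
    then show ?thesis unfolding sum_supply using x(1) by (intro bound) auto
  qed
  show ?thesis
  proof (rule min_cost_multiplier)
    show "case_sum p (\<lambda>_. 0) \<in> Inl ` M \<rightarrow> {0..}" using p by auto
    show "c \<le> (\<Sum>v\<in>Inl ` M. case_sum p (\<lambda>_. 0) v * x v)"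
      if "x \<in> Inl ` M \<rightarrow> {0..}" "feasible x f" "w \<le> net_flow G \<gamma> f t" for x f
      using that by (rule flow_bound)
    fix r
    assume r: "0 \<le> r" "\<And>x f. x \<in> Inl ` M \<rightarrow> {0..} \<Longrightarrow> feasible x f \<Longrightarrow>
      c + r * (net_flow G \<gamma> f t - w) \<le> (\<Sum>v\<in>Inl ` M. case_sum p (\<lambda>_. 0) v * x v)"
    show ?thesis
    proof (intro exI[of _ r] conjI ballI r(1))
      fix z :: "'g \<Rightarrow> real" assume z: "z \<in> M \<rightarrow> {0..}"
      obtain f where f: "feasible (case_sum z (\<lambda>_. 0)) f" "net_flow G \<gamma> f t = u z"
        using optimal_flow[OF z] .
      have "case_sum z (\<lambda>_. 0) \<in> Inl ` M \<rightarrow> {0..}" using z by auto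
      from r(2)[OF this f(1)] show "c + r * (u z - w) \<le> cost M p z"
        unfolding sum_supply f(2) by simp
    qed
  qed
qed

end

lemma gen_network_utilityE:
  assumes "gen_network_utility M u"
  obtains G t h \<gamma> where "network_utility G t M h \<gamma> u"
proof -
  obtain G :: "('a + nat, nat) pre_digraph" and t h \<gamma> where
    "gen_flow_instance G t (Inl ` M) h \<gamma>"
    "\<forall>x \<in> M \<rightarrow> {0..}. is_max_flow_value G t (Inl ` M) h \<gamma> (case_sum x (\<lambda>_. 0)) (u x)"
    using assms unfolding gen_network_utility_def by metis
  then have "network_utility G t M h \<gamma> u"
    by (simp add: network_utility_def network_utility_axioms_def)
  then show thesis by (rule that)
qed

section \<open>Lagrange multipliers\<close>

text \<open>
  Concavity of the objective and convexity of the constraints enter only through the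
  values they take, so the domain needs no linear structure.
\<close>

definition concave_convex :: "'z set \<Rightarrow> 'j set \<Rightarrow> ('z \<Rightarrow> real) \<Rightarrow> ('j \<Rightarrow> 'z \<Rightarrow> real) \<Rightarrow> bool" where
  "concave_convex C J F g \<longleftrightarrow> (\<forall>x\<in>C. \<forall>y\<in>C. \<forall>s\<in>{0..1}. \<exists>z\<in>C.
    (1 - s) * F x + s * F y \<le> F z \<and> (\<forall>j\<in>J. g j z \<le> (1 - s) * g j x + s * g j y))"

text \<open>In the plane of pairs \<open>(g j z, F z)\<close>, a line through \<open>(0, v)\<close>
  must lie above all attained points. Points with \<open>g j z < 0\<close> bound its slope from
  above and points with \<open>g j z > 0\<close> from below; \<open>q\<close> is the infimum of the
  upper bounds, a nonempty set by the Slater point.\<close>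

lemma lagrange_single:
  assumes conv: "concave_convex C {j} F g"
    and slater: "z0 \<in> C" "g j z0 < 0"
    and max: "\<And>z. z \<in> C \<Longrightarrow> g j z \<le> 0 \<Longrightarrow> F z \<le> v"
  shows "\<exists>q\<ge>0. \<forall>z\<in>C. F z - q * g j z \<le> v"
proof -
  define N where "N = {z \<in> C. g j z < 0}"
  define R where "R = (\<lambda>z. (v - F z) / (- g j z))"
  define q where "q = Inf (R ` N)"
  have R0: "0 \<le> R z" if "z \<in> N" for z
    using that max[of z] by (auto simp: N_def R_def divide_nonneg_neg divide_nonpos_neg)
  then have bdd: "bdd_below (R ` N)" by (auto intro!: bdd_belowI2[of _ 0])
  have ne: "R ` N \<noteq> {}" using slater by (auto simp: N_def)
  have "0 \<le> q" unfolding q_def using ne R0 by (intro cInf_greatest) auto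
  moreover have "F x - q * g j x \<le> v" if x: "x \<in> C" for x
  proof -
    consider "g j x < 0" | "g j x = 0" | "0 < g j x" by linarith
    then show ?thesis
    proof cases
      case 1
      then have "q \<le> R x" unfolding q_def using x bdd by (intro cInf_lower) (auto simp: N_def)
      then show ?thesis using 1 by (simp add: R_def field_simps)
    next
      case 2
      then show ?thesis using max[OF x] by simp
    next
      case 3
      have "(F x - v) / g j x \<le> R y" if y: "y \<in> N" for y
      proof -
        have gy: "g j y < 0" "y \<in> C" using y by (auto simp: N_def)
        \<comment> \<open>The weight at which the constraint values of \<open>x\<close> and
          \<open>y\<close> average to zero, so that the point supplied by convexity is feasible and
          has \<open>F\<close> at most \<open>v\<close>.\<close>
        define s where "s = g j x / (g j x - g j y)"
        have s: "s \<in> {0..1}" "(1 - s) * g j x + s * g j y = 0"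
          using gy 3 by (auto simp: s_def field_simps)
        obtain z where z: "z \<in> C" "(1 - s) * F x + s * F y \<le> F z" "g j z \<le> 0"
          using conv x gy(2) s unfolding concave_convex_def by fastforce
        have "(1 - s) * F x + s * F y \<le> v" using z max by force
        then have "(g j x - g j y) * ((1 - s) * F x + s * F y) \<le> (g j x - g j y) * v"
          using gy 3 by (intro mult_left_mono) auto
        moreover have "(g j x - g j y) * s = g j x" using gy 3 by (simp add: s_def)
        moreover have "(g j x - g j y) * ((1 - s) * F x + s * F y)
            = ((g j x - g j y) - (g j x - g j y) * s) * F x + ((g j x - g j y) * s) * F y"
          by (simp add: algebra_simps)
        ultimately have "- g j y * F x + g j x * F y \<le> (g j x - g j y) * v" by simp
        then show ?thesis using gy 3 by (simp add: R_def field_simps)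
      qed
      then have "(F x - v) / g j x \<le> q" unfolding q_def using ne by (intro cInf_greatest) auto
      then show ?thesis using 3 by (simp add: field_simps)
    qed
  qed
  ultimately show ?thesis by blast
qed

text \<open>Constraints are relaxed one at a time: first \<open>j\<close>, over the subdomain
  \<open>C'\<close> where the others still hold, then the others, with the penalty for
  \<open>j\<close> absorbed into the objective.\<close>

lemma lagrange_multipliers:
  assumes "finite J" "concave_convex C J F g"
    and slater: "z0 \<in> C" "\<And>j. j \<in> J \<Longrightarrow> g j z0 < 0"
    and "\<And>z. z \<in> C \<Longrightarrow> (\<And>j. j \<in> J \<Longrightarrow> g j z \<le> 0) \<Longrightarrow> F z \<le> v"
  shows "\<exists>q. (\<forall>j\<in>J. 0 \<le> q j) \<and> (\<forall>z\<in>C. F z - (\<Sum>j\<in>J. q j * g j z) \<le> v)"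
  using assms(1,2) slater(2) assms(5)
proof (induction J arbitrary: F rule: finite_induct)
  case empty
  then show ?case by simp
next
  case (insert j J)
  define C' where "C' = {z \<in> C. \<forall>k\<in>J. g k z \<le> 0}"
  have "\<exists>q\<ge>0. \<forall>z\<in>C'. F z - q * g j z \<le> v"
  proof (rule lagrange_single)
    show "concave_convex C' {j} F g"
      unfolding concave_convex_def
    proof (intro ballI)
      fix x y s assume x: "x \<in> C'" and y: "y \<in> C'" and s: "s \<in> {0..1::real}"
      then obtain z where z: "z \<in> C" "(1 - s) * F x + s * F y \<le> F z"
        "\<forall>k\<in>insert j J. g k z \<le> (1 - s) * g k x + s * g k y"
        using insert.prems(1) unfolding concave_convex_def C'_def by blast
      have "(1 - s) * g k x + s * g k y \<le> 0" if "k \<in> J" for k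
        using x y s that by (intro add_nonpos_nonpos mult_nonneg_nonpos) (auto simp: C'_def)
      then have "z \<in> C'" using z by (force simp: C'_def)
      then show "\<exists>z\<in>C'. (1 - s) * F x + s * F y \<le> F z \<and>
          (\<forall>j\<in>{j}. g j z \<le> (1 - s) * g j x + s * g j y)"
        using z by auto
    qed
    show "z0 \<in> C'" "g j z0 < 0" using slater(1) insert.prems(2) by (auto simp: C'_def less_imp_le)
    show "F z \<le> v" if "z \<in> C'" "g j z \<le> 0" for z
      using insert.prems(3)[of z] that by (auto simp: C'_def)
  qed
  then obtain m where m: "0 \<le> m" "\<And>z. z \<in> C' \<Longrightarrow> F z - m * g j z \<le> v" by blast
  have "\<exists>q. (\<forall>k\<in>J. 0 \<le> q k) \<and> (\<forall>z\<in>C. F z - m * g j z - (\<Sum>k\<in>J. q k * g k z) \<le> v)"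
  proof (rule insert.IH)
    show "concave_convex C J (\<lambda>z. F z - m * g j z) g"
      unfolding concave_convex_def
    proof (intro ballI)
      fix x y s assume "x \<in> C" "y \<in> C" "s \<in> {0..1::real}"
      then obtain z where z: "z \<in> C" "(1 - s) * F x + s * F y \<le> F z"
        "\<forall>k\<in>insert j J. g k z \<le> (1 - s) * g k x + s * g k y"
        using insert.prems(1) unfolding concave_convex_def by blast
      have "m * g j z \<le> m * ((1 - s) * g j x + s * g j y)"
        using z(3) m(1) by (intro mult_left_mono) auto
      then have "(1 - s) * (F x - m * g j x) + s * (F y - m * g j y) \<le> F z - m * g j z"
        using z(2) by (simp add: algebra_simps)
      then show "\<exists>z\<in>C. (1 - s) * (F x - m * g j x) + s * (F y - m * g j y) \<le> F z - m * g j z \<and>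
          (\<forall>k\<in>J. g k z \<le> (1 - s) * g k x + s * g k y)"
        using z by auto
    qed
    show "g k z0 < 0" if "k \<in> J" for k using insert.prems(2) that by simp
    show "F z - m * g j z \<le> v" if "z \<in> C" "\<And>k. k \<in> J \<Longrightarrow> g k z \<le> 0" for z
      using m(2) that by (simp add: C'_def)
  qed
  then obtain q where q: "\<forall>k\<in>J. 0 \<le> q k"
    "\<forall>z\<in>C. F z - m * g j z - (\<Sum>k\<in>J. q k * g k z) \<le> v" by blast
  have "(\<Sum>k\<in>insert j J. (q(j := m)) k * g k z) = m * g j z + (\<Sum>k\<in>J. q k * g k z)" for z
  proof -
    have "(\<Sum>k\<in>J. (q(j := m)) k * g k z) = (\<Sum>k\<in>J. q k * g k z)"
      using insert.hyps by (intro sum.cong) auto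
    then show ?thesis using insert.hyps by simp
  qed
  then show ?case
    using q m(1) by (intro exI[of _ "q(j := m)"]) (auto simp: algebra_simps)
qed

section \<open>Nash welfare maximizers and thrifty equilibria\<close>

lemma cost_lincomb: "cost M p (\<lambda>j. a * z j + c * z' j) = a * cost M p z + c * cost M p z'"
  by (simp add: cost_def sum.distrib sum_distrib_left algebra_simps)

lemma cost_nonneg: "p \<in> M \<rightarrow> {0..} \<Longrightarrow> z \<in> M \<rightarrow> {0..} \<Longrightarrow> 0 \<le> cost M p z"
  unfolding cost_def by (intro sum_nonneg mult_nonneg_nonneg) auto

lemma sum_cost: "(\<Sum>i\<in>A. cost M p (z i)) = (\<Sum>j\<in>M. p j * (\<Sum>i\<in>A. z i j))"
  unfolding cost_def by (subst sum.swap) (simp add: sum_distrib_left)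

lemma utility_nonneg: "gen_network_utility M u \<Longrightarrow> z \<in> M \<rightarrow> {0..} \<Longrightarrow> 0 \<le> u z"
  and utility_zero: "gen_network_utility M u \<Longrightarrow> u (\<lambda>_. 0) = 0"
  by (auto simp: gen_network_utility_def)

lemma utility_concave:
  assumes "gen_network_utility M u" "z \<in> M \<rightarrow> {0..}" "z' \<in> M \<rightarrow> {0..}" "0 \<le> s" "s \<le> 1"
  shows "(1 - s) * u z + s * u z' \<le> u (\<lambda>j. (1 - s) * z j + s * z' j)"
  using assms by (elim gen_network_utilityE) (rule network_utility.concave)

text \<open>Scaling down bundles of positive utility gives a feasible allocation of positive Nash
  welfare, by concavity and \<open>u 0 = 0\<close>. A maximizer therefore has positive welfare too,
  and no factor of its product vanishes.\<close>

lemma nash_positive: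
  fixes A :: "'a set"
  assumes fin: "finite A" "finite M" and b: "\<And>i. i \<in> A \<Longrightarrow> 0 < b i"
    and u: "\<And>i. i \<in> A \<Longrightarrow> gen_network_utility M (u i)"
    and nash: "nash_welfare_maximizing A M u b y" and k: "k \<in> A"
  shows "0 < u k (y k)"
proof -
  have y: "y \<in> feasible_allocations A M"
    "\<And>w. w \<in> feasible_allocations A M \<Longrightarrow> nash_welfare A u b w \<le> nash_welfare A u b y"
    using nash by (auto simp: nash_welfare_maximizing_def is_arg_max_def not_less)
  have "\<forall>i. \<exists>z. i \<in> A \<longrightarrow> z \<in> M \<rightarrow> {0..} \<and> 0 < u i z"
    using u unfolding gen_network_utility_def by blast
  then obtain z where z: "\<And>i. i \<in> A \<Longrightarrow> z i \<in> M \<rightarrow> {0..}" "\<And>i. i \<in> A \<Longrightarrow> 0 < u i (z i)" by metis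
  \<comment> \<open>Dividing by the total amount of all goods used respects every unit supply; the
    added 1 keeps the denominator positive and gives \<open>s \<le> 1\<close>.\<close>
  define s where "s = 1 / (1 + (\<Sum>j\<in>M. \<Sum>i\<in>A. z i j))"
  have znn: "0 \<le> (\<Sum>i\<in>A. z i j)" if "j \<in> M" for j
    using z(1) that by (intro sum_nonneg) (auto simp: Pi_iff)
  then have Z: "0 \<le> (\<Sum>j\<in>M. \<Sum>i\<in>A. z i j)" by (rule sum_nonneg)
  then have s: "0 < s" "s \<le> 1" by (auto simp: s_def)
  define w where "w = (\<lambda>i j. s * z i j)"
  have "(\<Sum>i\<in>A. w i j) \<le> 1" if j: "j \<in> M" for j
  proof -
    have "(\<Sum>i\<in>A. z i j) \<le> (\<Sum>j\<in>M. \<Sum>i\<in>A. z i j)"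
      using j fin znn by (intro member_le_sum) auto
    then have "s * (\<Sum>i\<in>A. z i j) \<le> s * (1 + (\<Sum>j\<in>M. \<Sum>i\<in>A. z i j))"
      using s by (intro mult_left_mono) auto
    also have "\<dots> = 1" using Z by (simp add: s_def)
    finally show ?thesis by (simp add: w_def sum_distrib_left)
  qed
  then have "w \<in> feasible_allocations A M"
    using z(1) s by (auto simp: feasible_allocations_def w_def Pi_iff)
  moreover have "0 < u i (w i)" if i: "i \<in> A" for i
  proof -
    have "(\<lambda>_. 0) \<in> M \<rightarrow> {0::real..}" by auto
    from utility_concave[OF u[OF i] this z(1)[OF i], of s]
    have "s * u i (z i) \<le> u i (w i)"
      using s utility_zero[OF u[OF i]] by (simp add: w_def)
    moreover have "0 < s * u i (z i)" using s z(2)[OF i] by simp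
    ultimately show ?thesis by linarith
  qed
  then have "0 < (\<Prod>i\<in>A. u i (w i) powr b i)" by (intro prod_pos) (metis powr_gt_zero less_irrefl)
  then have "0 < nash_welfare A u b w" by (simp add: nash_welfare_def)
  ultimately have "0 < nash_welfare A u b y" using y(2) by fastforce
  then have "(\<Prod>i\<in>A. u i (y i) powr b i) \<noteq> 0" by (auto simp: nash_welfare_def)
  then have "u k (y k) \<noteq> 0" using k fin by (auto simp: prod_zero_iff)
  moreover have "0 \<le> u k (y k)"
    using utility_nonneg[OF u[OF k]] y(1) k by (auto simp: feasible_allocations_def)
  ultimately show ?thesis by simp
qed

text \<open>First-order optimality of \<open>y\<close> for the logarithm of Nash welfare. Otherwise
  a short move towards \<open>z\<close> would increase the welfare, since concavity bounds each
  utility on the segment from below by linear interpolation.\<close>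

lemma nash_first_order:
  fixes A :: "'a set"
  assumes fin: "finite A" "finite M" and b: "\<And>i. i \<in> A \<Longrightarrow> 0 < b i"
    and u: "\<And>i. i \<in> A \<Longrightarrow> gen_network_utility M (u i)"
    and nash: "nash_welfare_maximizing A M u b y"
    and z: "z \<in> feasible_allocations A M"
  shows "(\<Sum>i\<in>A. b i / u i (y i) * u i (z i)) \<le> (\<Sum>i\<in>A. b i / u i (y i) * u i (y i))"
proof (rule ccontr)
  assume contr: "\<not> ?thesis"
  define uy where "uy = (\<lambda>i. u i (y i))"
  define uz where "uz = (\<lambda>i. u i (z i))"
  have uy: "0 < uy i" if "i \<in> A" for i
    unfolding uy_def using nash_positive[OF fin b u nash that] .
  have y: "y \<in> feasible_allocations A M"
    "\<And>w. w \<in> feasible_allocations A M \<Longrightarrow> nash_welfare A u b w \<le> nash_welfare A u b y"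
    using nash by (auto simp: nash_welfare_maximizing_def is_arg_max_def not_less)
  have mem: "y i \<in> M \<rightarrow> {0..}" "z i \<in> M \<rightarrow> {0..}" if "i \<in> A" for i
    using y(1) z that by (auto simp: feasible_allocations_def)
  have uz: "0 \<le> uz i" if "i \<in> A" for i
    unfolding uz_def using utility_nonneg[OF u[OF that] mem(2)[OF that]] .
  \<comment> \<open>Built from interpolated utility values, \<open>\<phi>\<close> is differentiable
    at 0 and a lower bound for the log welfare along the segment, exact at 0.\<close>
  define \<phi> where "\<phi> = (\<lambda>s. \<Sum>i\<in>A. b i * ln ((1 - s) * uy i + s * uz i))"
  have "(\<phi> has_real_derivative (\<Sum>i\<in>A. b i * ((uz i - uy i) / uy i))) (at 0)"
    unfolding \<phi>_def using uy
    by (auto intro!: derivative_eq_intros sum.cong simp: field_simps)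
  moreover have "0 < (\<Sum>i\<in>A. b i * ((uz i - uy i) / uy i))"
  proof -
    have "(\<Sum>i\<in>A. b i * ((uz i - uy i) / uy i))
        = (\<Sum>i\<in>A. b i / uy i * uz i) - (\<Sum>i\<in>A. b i / uy i * uy i)"
      unfolding sum_subtractf[symmetric] by (intro sum.cong) (simp_all add: field_simps)
    then show ?thesis using contr by (simp add: uy_def uz_def)
  qed
  ultimately obtain d where d: "0 < d" "\<And>s. 0 < s \<Longrightarrow> s < d \<Longrightarrow> \<phi> 0 < \<phi> s"
    using has_real_derivative_pos_inc_right[of \<phi> _ 0 UNIV] by auto
  define s where "s = min d 1 / 2"
  have s: "0 < s" "s < 1" "s < d" using d(1) by (auto simp: s_def min_def)
  define w where "w = (\<lambda>i j. (1 - s) * y i j + s * z i j)"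
  have lower: "(1 - s) * uy i + s * uz i \<le> u i (w i)" if "i \<in> A" for i
    unfolding uy_def uz_def w_def using s utility_concave[OF u[OF that] mem[OF that]] by simp
  have pos: "0 < (1 - s) * uy i + s * uz i" if "i \<in> A" for i
    using s uy[OF that] uz[OF that] by (intro add_pos_nonneg) auto
  have "w \<in> feasible_allocations A M"
  proof -
    have "(\<Sum>i\<in>A. w i j) \<le> 1" if "j \<in> M" for j
    proof -
      have "(\<Sum>i\<in>A. w i j) = (1 - s) * (\<Sum>i\<in>A. y i j) + s * (\<Sum>i\<in>A. z i j)"
        by (simp add: w_def sum.distrib sum_distrib_left)
      also have "\<dots> \<le> 1"
        using y(1) z that s by (intro convex_bound_le) (auto simp: feasible_allocations_def)
      finally show ?thesis .
    qed
    then show ?thesis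
      using mem s by (auto simp: feasible_allocations_def w_def Pi_iff)
  qed
  then have "nash_welfare A u b w \<le> nash_welfare A u b y" by (rule y(2))
  moreover have "nash_welfare A u b y < nash_welfare A u b w"
  proof -
    \<comment> \<open>For empty \<open>A\<close> both sums are 0, against \<open>contr\<close>.
      Nonemptiness makes the total budget positive, so the outer root is strictly
      increasing.\<close>
    have ne: "A \<noteq> {}" using contr by auto
    have prod_exp: "(\<Prod>i\<in>A. c i powr b i) = exp (\<Sum>i\<in>A. b i * ln (c i))"
      if "\<And>i. i \<in> A \<Longrightarrow> 0 < c i" for c
      unfolding exp_sum[OF fin(1)]
      by (intro prod.cong) (auto simp: powr_def dest!: that)
    have "(\<Sum>i\<in>A. b i * ln (uy i)) < \<phi> s"
      using d(2)[OF s(1,3)] by (simp add: \<phi>_def)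
    also have "\<phi> s \<le> (\<Sum>i\<in>A. b i * ln (u i (w i)))"
      unfolding \<phi>_def using lower pos b
      by (intro sum_mono mult_left_mono) (auto simp: less_imp_le intro!: ln_mono less_le_trans[OF pos])
    finally have "(\<Prod>i\<in>A. u i (y i) powr b i) < (\<Prod>i\<in>A. u i (w i) powr b i)"
      using uy lower pos by (subst (1 2) prod_exp) (force simp: uy_def)+
    moreover have "0 < (\<Sum>i\<in>A. b i)" using b fin ne by (intro sum_pos)
    ultimately show ?thesis
      unfolding nash_welfare_def by (intro powr_less_mono2) (auto intro!: prod_nonneg)
  qed
  ultimately show False by simp
qed

text \<open>By \<open>nash_first_order\<close>, \<open>y\<close> maximizes the sum of utilities
  weighted by \<open>b i / u i (y i)\<close> under the supply constraints; \<open>q\<close> are the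
  Lagrange multipliers of these constraints.\<close>

lemma nash_prices:
  fixes A :: "'a set" and M :: "'g set"
  assumes fin: "finite A" "finite M" and b: "\<And>i. i \<in> A \<Longrightarrow> 0 < b i"
    and u: "\<And>i. i \<in> A \<Longrightarrow> gen_network_utility M (u i)"
    and nash: "nash_welfare_maximizing A M u b y"
  obtains q where "q \<in> M \<rightarrow> {0..}" "(\<Sum>i\<in>A. cost M q (y i)) = (\<Sum>j\<in>M. q j)"
    "\<And>i z. i \<in> A \<Longrightarrow> z \<in> M \<rightarrow> {0..} \<Longrightarrow>
      b i / u i (y i) * u i z - cost M q z \<le> b i / u i (y i) * u i (y i) - cost M q (y i)"
proof -
  define r where "r = (\<lambda>i. b i / u i (y i))"
  define C :: "('a \<Rightarrow> 'g \<Rightarrow> real) set" where "C = {z. \<forall>i\<in>A. z i \<in> M \<rightarrow> {0..}}"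
  define F where "F = (\<lambda>z. \<Sum>i\<in>A. r i * u i (z i))"
  define g where "g = (\<lambda>(j :: 'g) (z :: 'a \<Rightarrow> 'g \<Rightarrow> real). (\<Sum>i\<in>A. z i j) - 1)"
  have y: "y \<in> feasible_allocations A M"
    using nash by (auto simp: nash_welfare_maximizing_def is_arg_max_def)
  then have yC: "y \<in> C" by (simp add: C_def feasible_allocations_def)
  have r: "0 \<le> r i" if "i \<in> A" for i
    using nash_positive[OF fin b u nash that] b[OF that] by (simp add: r_def)
  have "\<exists>q. (\<forall>j\<in>M. 0 \<le> q j) \<and> (\<forall>z\<in>C. F z - (\<Sum>j\<in>M. q j * g j z) \<le> F y)"
  proof (rule lagrange_multipliers)
    show "concave_convex C M F g"
      unfolding concave_convex_def
    proof (intro ballI)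
      fix x z and s :: real assume x: "x \<in> C" and z: "z \<in> C" and s: "s \<in> {0..1}"
      define w where "w = (\<lambda>i j. (1 - s) * x i j + s * z i j)"
      have "w \<in> C" using x z s by (auto simp: C_def w_def Pi_iff)
      moreover have "(1 - s) * F x + s * F z \<le> F w"
      proof -
        have "(1 - s) * F x + s * F z = (\<Sum>i\<in>A. r i * ((1 - s) * u i (x i) + s * u i (z i)))"
          unfolding F_def sum_distrib_left sum.distrib[symmetric]
          by (intro sum.cong) (simp_all add: algebra_simps)
        also have "\<dots> \<le> F w"
          unfolding F_def w_def using x z s r utility_concave[OF u]
          by (intro sum_mono mult_left_mono) (auto simp: C_def)
        finally show ?thesis .
      qed
      moreover have "g j w = (1 - s) * g j x + s * g j z" for j
        by (simp add: g_def w_def sum.distrib sum_subtractf sum_distrib_left[symmetric] algebra_simps)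
      ultimately show "\<exists>w\<in>C. (1 - s) * F x + s * F z \<le> F w \<and>
          (\<forall>j\<in>M. g j w \<le> (1 - s) * g j x + s * g j z)" by (intro bexI[of _ w]) auto
    qed
    \<comment> \<open>The zero allocation leaves a full unit of every good and so is a Slater
      point.\<close>
    show "(\<lambda>_ _. 0) \<in> C" by (auto simp: C_def)
    show "g j (\<lambda>_ _. 0) < 0" for j by (simp add: g_def)
    show "F z \<le> F y" if "z \<in> C" "\<And>j. j \<in> M \<Longrightarrow> g j z \<le> 0" for z
      unfolding F_def r_def using that
      by (intro nash_first_order[OF fin b u nash]) (auto simp: C_def g_def feasible_allocations_def)
  qed (use fin in auto)
  then obtain q where q: "\<forall>j\<in>M. 0 \<le> q j"
    and "\<And>z. z \<in> C \<Longrightarrow> F z - (\<Sum>j\<in>M. q j * g j z) \<le> F y" by blast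
  moreover have "(\<Sum>j\<in>M. q j * g j z) = (\<Sum>i\<in>A. cost M q (z i)) - (\<Sum>j\<in>M. q j)" for z
    by (simp add: sum_cost g_def sum_subtractf right_diff_distrib)
  ultimately have le: "F z - (\<Sum>i\<in>A. cost M q (z i)) + (\<Sum>j\<in>M. q j) \<le> F y" if "z \<in> C" for z
    using that by (metis diff_diff_eq2 add_diff_eq diff_add_eq)
  \<comment> \<open>Complementary slackness, from the Lagrange inequality at \<open>y\<close>
    itself.\<close>
  have eq: "(\<Sum>i\<in>A. cost M q (y i)) = (\<Sum>j\<in>M. q j)"
  proof (rule antisym)
    have "(\<Sum>j\<in>M. q j * (\<Sum>i\<in>A. y i j)) \<le> (\<Sum>j\<in>M. q j * 1)"
      using q y by (intro sum_mono mult_left_mono) (auto simp: feasible_allocations_def)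
    then show "(\<Sum>i\<in>A. cost M q (y i)) \<le> (\<Sum>j\<in>M. q j)" by (simp add: sum_cost)
  qed (use le[OF yC] in simp)
  show thesis
  proof (rule that[OF _ eq])
    show "q \<in> M \<rightarrow> {0..}" using q by auto
    fix i and z :: "'g \<Rightarrow> real" assume i: "i \<in> A" and z: "z \<in> M \<rightarrow> {0..}"
    \<comment> \<open>Changing one bundle separates the joint optimality into the optimality of each
      agent.\<close>
    have "y(i := z) \<in> C" using yC z by (auto simp: C_def)
    from le[OF this] show "b i / u i (y i) * u i z - cost M q z
        \<le> b i / u i (y i) * u i (y i) - cost M q (y i)"
      using eq by (simp add: F_def r_def sum.remove[OF fin(1) i])
  qed
qed

text \<open>Thriftiness makes \<open>x\<close> a cheapest bundle of its utility level, so
  \<open>expenditure_multiplier\<close> supplies \<open>r\<close>. If the budget is exhausted,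
  comparison with the zero bundle gives \<open>b \<le> r * u x\<close>. Otherwise \<open>x\<close>
  maximizes \<open>u\<close> globally and \<open>r\<close> can be raised above any given
  \<open>s\<close>.\<close>

lemma thrifty_multiplier:
  fixes M :: "'g set"
  assumes u: "gen_network_utility M u" and p: "p \<in> M \<rightarrow> {0..}"
    and x: "is_arg_min (cost M p) (\<lambda>z. z \<in> demand M u p b) x"
  obtains r where "0 \<le> r"
    "\<And>z. z \<in> M \<rightarrow> {0..} \<Longrightarrow> r * u z - cost M p z \<le> r * u x - cost M p x"
    "b \<le> r * u x \<or> s \<le> r"
proof -
  have xdem: "x \<in> demand M u p b"
    "\<And>z. z \<in> demand M u p b \<Longrightarrow> cost M p x \<le> cost M p z"
    using x by (auto simp: is_arg_min_def not_less)
  then have xM: "x \<in> M \<rightarrow> {0..}" "cost M p x \<le> b"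
    and best: "\<And>z. z \<in> M \<rightarrow> {0..} \<Longrightarrow> cost M p z \<le> b \<Longrightarrow> u z \<le> u x"
    by (auto simp: demand_def is_arg_max_def not_less)
  have cheapest: "cost M p x \<le> cost M p z" if z: "z \<in> M \<rightarrow> {0..}" "u x \<le> u z" for z
  proof (rule ccontr)
    assume c: "\<not> cost M p x \<le> cost M p z"
    then have "z \<in> demand M u p b"
      using z xM(2) best by (auto simp: demand_def is_arg_max_def not_less intro: order_trans)
    then show False using xdem(2) c by auto
  qed
  obtain G t h \<gamma> where "network_utility G t M h \<gamma> u"
    using u by (rule gen_network_utilityE)
  then have "\<exists>r\<ge>0. \<forall>z\<in>M \<rightarrow> {0..}. cost M p x + r * (u z - u x) \<le> cost M p z"
    using p cheapest by (rule network_utility.expenditure_multiplier)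
  then obtain r where r: "0 \<le> r"
    "\<And>z. z \<in> M \<rightarrow> {0..} \<Longrightarrow> cost M p x + r * (u z - u x) \<le> cost M p z" by blast
  show thesis
  proof (cases "cost M p x = b")
    case True
    have "cost M p x + r * (0 - u x) \<le> 0"
      using r(2)[of "\<lambda>_. 0"] utility_zero[OF u] by (simp add: cost_def)
    then show thesis
      using r True by (intro that[of r]) (auto simp: algebra_simps)
  next
    case False
    then have slack: "cost M p x < b" using xM(2) by simp
    have sat: "u z \<le> u x" if z: "z \<in> M \<rightarrow> {0..}" for z
    proof (rule ccontr)
      assume more: "\<not> u z \<le> u x"
      then have cz: "b < cost M p z" using best[OF z] by (metis not_le)
      \<comment> \<open>The mixture of \<open>x\<close> and \<open>z\<close> with this weight costs
        exactly \<open>b\<close>; by concavity it would be better than \<open>x\<close>.\<close>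
      define s where "s = (b - cost M p x) / (cost M p z - cost M p x)"
      have s: "0 < s" "s \<le> 1" using slack cz by (auto simp: s_def field_simps)
      let ?w = "\<lambda>j. (1 - s) * x j + s * z j"
      have "s * (cost M p z - cost M p x) = b - cost M p x"
        using slack cz by (simp add: s_def)
      then have "cost M p ?w \<le> b" unfolding cost_lincomb by (simp add: algebra_simps)
      moreover have "?w \<in> M \<rightarrow> {0..}" using xM(1) z s by (auto simp: Pi_iff)
      ultimately have "u ?w \<le> u x" using best by blast
      moreover have "(1 - s) * u x + s * u z \<le> u ?w"
        using utility_concave[OF u xM(1) z] s by simp
      moreover have "0 < s * (u z - u x)" using s more by simp
      ultimately show False by (simp add: algebra_simps)
    qed
    show thesis
    proof (rule that[of "max r s"])
      fix z :: "'g \<Rightarrow> real" assume z: "z \<in> M \<rightarrow> {0..}"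
      have "max r s * (u z - u x) \<le> r * (u z - u x)"
        using sat[OF z] by (intro mult_right_mono_neg) auto
      then show "max r s * u z - cost M p z \<le> max r s * u x - cost M p x"
        using r(2)[OF z] by (simp add: algebra_simps)
    qed (use r(1) in auto)
  qed
qed

section \<open>Comparison of equilibrium prices with Lagrange prices\<close>

theorem theorem1p6:
  fixes A :: "'a set" and M :: "'g set"
    and b :: "'a \<Rightarrow> real" and u :: "'a \<Rightarrow> ('g \<Rightarrow> real) \<Rightarrow> real"
    and x y :: "'a \<Rightarrow> 'g \<Rightarrow> real" and p :: "'g \<Rightarrow> real"
  assumes "finite A" and "finite M"
    and "\<And>i. i \<in> A \<Longrightarrow> 0 < b i"
    and "\<And>i. i \<in> A \<Longrightarrow> gen_network_utility M (u i)"
    and "thrifty_competitive_equilibrium A M u b x p"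
    and "nash_welfare_maximizing A M u b y"
  shows "\<forall>i\<in>A. u i (y i) \<ge> 1 / 2 * u i (x i)"
proof
  fix i assume i: "i \<in> A"
  note b = assms(3) and util = assms(4)
  have p: "p \<in> M \<rightarrow> {0..}"
    and x: "\<And>k. k \<in> A \<Longrightarrow> is_arg_min (cost M p) (\<lambda>z. z \<in> demand M (u k) p (b k)) (x k)"
    and capacity: "\<And>j. j \<in> M \<Longrightarrow> (\<Sum>k\<in>A. x k j) \<le> 1"
    using assms(5)
    by (auto simp: thrifty_competitive_equilibrium_def competitive_equilibrium_def)
  have xM: "x k \<in> M \<rightarrow> {0..}" "cost M p (x k) \<le> b k" if "k \<in> A" for k
    using x[OF that] by (auto simp: is_arg_min_def is_arg_max_def demand_def)
  have y: "y \<in> feasible_allocations A M"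
    using assms(6) by (auto simp: nash_welfare_maximizing_def is_arg_max_def)
  have yM: "y k \<in> M \<rightarrow> {0..}" if "k \<in> A" for k
    using y that by (auto simp: feasible_allocations_def)
  have uy: "0 < u k (y k)" if "k \<in> A" for k
    using nash_positive[OF assms(1-4,6) that] .
  define r where "r = (\<lambda>k. b k / u k (y k))"
  obtain q where q: "q \<in> M \<rightarrow> {0..}" "(\<Sum>k\<in>A. cost M q (y k)) = (\<Sum>j\<in>M. q j)"
    and qy: "\<And>k z. k \<in> A \<Longrightarrow> z \<in> M \<rightarrow> {0..} \<Longrightarrow>
      r k * u k z - cost M q z \<le> r k * u k (y k) - cost M q (y k)"
    unfolding r_def using nash_prices[OF assms(1-4,6)] by blast
  \<comment> \<open>The free parameter of \<open>thrifty_multiplier\<close> is set to the Nash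
    weight \<open>r k\<close>.\<close>
  have "\<forall>k\<in>A. \<exists>r'\<ge>0. (\<forall>z\<in>M \<rightarrow> {0..}. r' * u k z - cost M p z \<le> r' * u k (x k) - cost M p (x k))
      \<and> (b k \<le> r' * u k (x k) \<or> r k \<le> r')"
    using thrifty_multiplier[OF util p x] by metis
  then obtain r' where r'0: "\<And>k. k \<in> A \<Longrightarrow> 0 \<le> r' k"
    and px: "\<And>k z. k \<in> A \<Longrightarrow> z \<in> M \<rightarrow> {0..} \<Longrightarrow>
      r' k * u k z - cost M p z \<le> r' k * u k (x k) - cost M p (x k)"
    and r': "\<And>k. k \<in> A \<Longrightarrow> b k \<le> r' k * u k (x k) \<or> r k \<le> r' k"
    by metis
  define m where "m = (\<lambda>k. min (r' k) (r k))"
  define l where "l = (\<lambda>j. min (p j) (q j))"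
  \<comment> \<open>Submodularity summed over the agents, with the maximum side evaluated at
    \<open>x k\<close>. Charging maximal prices instead of \<open>p\<close> costs
    \<open>q - l\<close> per unit, on at most one unit of each good; this cancels the total
    \<open>q\<close> collected from \<open>y\<close> up to the sum of \<open>l\<close>. The bundles
    \<open>w\<close> may exceed the supply.\<close>
  have key: "(\<Sum>k\<in>A. m k * u k (w k)) - (\<Sum>k\<in>A. cost M l (w k)) + (\<Sum>j\<in>M. l j)
      \<le> (\<Sum>k\<in>A. (m k - r k) * u k (x k) + r k * u k (y k))"
    if w: "\<And>k. k \<in> A \<Longrightarrow> w k \<in> M \<rightarrow> {0..}" for w
  proof -
    let ?h = "\<lambda>j. max (p j) (q j)"
    have "m k * u k (w k) - cost M l (w k)
        \<le> (m k - r k) * u k (x k) + r k * u k (y k)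
          + (cost M ?h (x k) - cost M p (x k)) - cost M q (y k)" if k: "k \<in> A" for k
    proof -
      obtain G t h \<gamma> where "network_utility G t M h \<gamma> (u k)"
        using util[OF k] by (rule gen_network_utilityE)
      from network_utility.submodular[OF this r'0[OF k] _ px[OF k] qy[OF k] w[OF k] xM(1)[OF k]]
      have "m k * u k (w k) - cost M l (w k) + (max (r' k) (r k) * u k (x k) - cost M ?h (x k))
          \<le> (r' k * u k (x k) - cost M p (x k)) + (r k * u k (y k) - cost M q (y k))"
        using b[OF k] uy[OF k] by (simp add: m_def l_def r_def)
      moreover have "max (r' k) (r k) = r' k + r k - m k" by (simp add: m_def)
      ultimately show ?thesis by (simp add: algebra_simps)
    qed
    then have "(\<Sum>k\<in>A. m k * u k (w k) - cost M l (w k))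
        \<le> (\<Sum>k\<in>A. (m k - r k) * u k (x k) + r k * u k (y k)
          + (cost M ?h (x k) - cost M p (x k)) - cost M q (y k))"
      by (rule sum_mono)
    moreover have "(\<Sum>k\<in>A. cost M ?h (x k) - cost M p (x k)) \<le> (\<Sum>j\<in>M. q j - l j)"
    proof -
      have "(\<Sum>k\<in>A. cost M ?h (x k) - cost M p (x k)) = (\<Sum>j\<in>M. (q j - l j) * (\<Sum>k\<in>A. x k j))"
        unfolding sum_subtractf sum_cost
        unfolding sum_subtractf[symmetric] left_diff_distrib[symmetric]
        by (intro sum.cong) (auto simp: l_def min_def max_def)
      also have "\<dots> \<le> (\<Sum>j\<in>M. (q j - l j) * 1)"
        using capacity by (intro sum_mono mult_left_mono) (auto simp: l_def)
      finally show ?thesis by simp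
    qed
    ultimately show ?thesis
      using q(2) by (simp add: sum.distrib sum_subtractf)
  qed
  have l0: "0 \<le> l j" if "j \<in> M" for j using p q(1) that by (auto simp: l_def)
  have l_supply: "(\<Sum>j\<in>M. l j * (\<Sum>k\<in>A. y k j)) \<le> (\<Sum>j\<in>M. l j)"
  proof -
    have "(\<Sum>j\<in>M. l j * (\<Sum>k\<in>A. y k j)) \<le> (\<Sum>j\<in>M. l j * 1)"
      using y l0 by (intro sum_mono mult_left_mono) (auto simp: feasible_allocations_def)
    then show ?thesis by simp
  qed
  \<comment> \<open>If \<open>r' k < r k\<close>, then \<open>b k \<le> r' k * u k (x k)\<close>,
    whereas \<open>r' k * u k (y k) < r k * u k (y k) = b k\<close>; hence \<open>x k\<close> has
    the larger utility.\<close>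
  have gap: "0 \<le> (r k - m k) * (u k (x k) - u k (y k))"
    "m k \<noteq> r k \<Longrightarrow> 0 < (r k - m k) * (u k (x k) - u k (y k))" if k: "k \<in> A" for k
  proof -
    have "u k (y k) < u k (x k)" if less: "r' k < r k"
    proof -
      have "b k \<le> r' k * u k (x k)" using r'[OF k] less by auto
      moreover have "r' k * u k (y k) < b k"
        using less uy[OF k] by (simp add: r_def field_simps)
      ultimately have "r' k * u k (y k) < r' k * u k (x k)" by linarith
      then show ?thesis using r'0[OF k] by (simp add: mult_less_cancel_left)
    qed
    then have "m k = r k \<or> m k < r k \<and> u k (y k) < u k (x k)" by (auto simp: m_def)
    then show "0 \<le> (r k - m k) * (u k (x k) - u k (y k))"
      "m k \<noteq> r k \<Longrightarrow> 0 < (r k - m k) * (u k (x k) - u k (y k))"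
      by auto
  qed
  \<comment> \<open>Taking \<open>w = y\<close> in \<open>key\<close> forces all gaps to vanish. So
    \<open>m = r\<close> on \<open>A\<close>, and the prices \<open>l\<close> support
    \<open>y\<close> with the original weights.\<close>
  have "(\<Sum>k\<in>A. (r k - m k) * (u k (x k) - u k (y k))) \<le> 0"
    using key[of y, OF yM] l_supply
    by (simp add: sum_cost sum.distrib sum_subtractf algebra_simps)
  then have "(\<Sum>k\<in>A. (r k - m k) * (u k (x k) - u k (y k))) = 0"
    using gap(1) by (intro antisym sum_nonneg)
  then have mr: "m k = r k" if "k \<in> A" for k
    using sum_nonneg_eq_0_iff[OF assms(1) gap(1)] gap(2)[OF that] that by force
  \<comment> \<open>Giving agent \<open>i\<close> the bundle \<open>x i\<close> in
    \<open>key\<close> isolates this agent: the weighted utility gain is at most the cost of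
    \<open>x i\<close> under \<open>l \<le> p\<close>, hence at most \<open>b i\<close>. Since
    \<open>r i = b i / u i (y i)\<close>, this is the factor 2.\<close>
  have "(\<Sum>k\<in>A. cost M l ((y(i := x i)) k)) = (\<Sum>k\<in>A. cost M l (y k)) - cost M l (y i) + cost M l (x i)"
    by (simp add: sum.remove[OF assms(1) i])
  moreover have "0 \<le> cost M l (y i)" using l0 yM[OF i] by (intro cost_nonneg) auto
  moreover have "cost M l (x i) \<le> b i"
  proof -
    have "cost M l (x i) \<le> cost M p (x i)"
      unfolding cost_def using xM(1)[OF i] by (intro sum_mono mult_right_mono) (auto simp: l_def)
    then show ?thesis using xM(2)[OF i] by simp
  qed
  moreover have "(\<Sum>k\<in>A. m k * u k ((y(i := x i)) k))
      = (\<Sum>k\<in>A. r k * u k (y k)) + r i * (u i (x i) - u i (y i))"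
    using mr by (simp add: sum.remove[OF assms(1) i] algebra_simps)
  moreover have "(\<Sum>k\<in>A. (m k - r k) * u k (x k) + r k * u k (y k)) = (\<Sum>k\<in>A. r k * u k (y k))"
    using mr by simp
  moreover have "(y(i := x i)) k \<in> M \<rightarrow> {0..}" if "k \<in> A" for k
    using yM[OF that] xM(1)[OF i] by simp
  note key[of "y(i := x i)", OF this]
  ultimately have "r i * (u i (x i) - u i (y i)) \<le> b i"
    using l_supply by (simp add: sum_cost)
  then show "u i (y i) \<ge> 1 / 2 * u i (x i)"
    using uy[OF i] b[OF i] by (simp add: r_def field_simps)
qed

end
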